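(* Let $T$ be a tree of order $n\ge4$ which is not isomorphic to the star $K_{1,n-1}$. Then $\xi_2(T^c)\ge\xi_2\big((T_{n,3}^{0,n-4})^c\big)$, with equality if and only if $T\cong T_{n,3}^{0,n-4}$.
   Context: For a connected graph $G$, the eccentricity matrix $\mathcal{E}(G)$ is the matrix indexed by $V(G)$ whose $(u,v)$-entry is $d_G(u,v)$ if $d_G(u,v)=\min\{e_G(u),e_G(v)\}$ and $0$ otherwise, where $d_G$ is the graph distance and $e_G(u)=\max_v d_G(u,v)$. $\xi_2(G)$ denotes the second largest eigenvalue of $\mathcal{E}(G)$. $T^c$ is the complement of $T$. $T_{n,3}^{0,n-4}$ is the tree obtained from the path $v_0v_1v_2v_3$ by attaching $n-4$ pendant vertices to $v_2$. *)

theory Defs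
  imports
    "Graph_Theory.Graph_Theory"
    "Jordan_Normal_Form.Char_Poly"
    "HOL-Combinatorics.List_Permutation"
begin

section \<open>Graphs\<close>

text \<open>
  A finite simple graph is a \<open>pair_graph\<close> of the library: finite, loopfree, and with a symmetric
  set of arcs, so that an edge \<open>uv\<close> is the pair of arcs \<open>(u, v)\<close> and \<open>(v, u)\<close>.

  The library constant \<open>Digraph_Component.tree\<close> is not usable for such graphs: in a symmetric
  digraph the closed walk \<open>u, v, u\<close> along an edge counts as a \<open>cycle\<close>. The cycles of the
  underlying undirected simple graph are exactly the library cycles of length at least 3.
\<close>

definition is_tree :: "'a pair_pre_digraph \<Rightarrow> bool" where
  "is_tree G \<longleftrightarrow> pair_graph G \<and> Digraph_Component.connected (with_proj G) \<and>
     \<not> (\<exists>p. pre_digraph.cycle (with_proj G) p \<and> 3 \<le> length p)"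

definition compl_graph :: "'a pair_pre_digraph \<Rightarrow> 'a pair_pre_digraph" where
  "compl_graph G = \<lparr> pverts = pverts G,
     parcs = {(u, v). u \<in> pverts G \<and> v \<in> pverts G \<and> u \<noteq> v \<and> (u, v) \<notin> parcs G} \<rparr>"

text \<open>
  The path \<open>0, 1, 2, 3\<close> with the \<open>n - 4\<close> further vertices \<open>4, \<dots>, n - 1\<close> attached to vertex \<open>2\<close>;
  meaningful for \<open>n \<ge> 4\<close>.
\<close>

definition tree_n3 :: "nat \<Rightarrow> nat pair_pre_digraph" where
  "tree_n3 n = (let E = {(0, 1), (1, 2), (2, 3)} \<union> {(2, k) | k. 4 \<le> k \<and> k < n}
     in \<lparr> pverts = {..<n}, parcs = E \<union> E\<inverse> \<rparr>)"

section \<open>Distance, eccentricity and the eccentricity matrix\<close>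

text \<open>
  The library distance \<open>\<mu>\<close> is the infimum of the costs of all walks, here with unit arc costs. It is
  extended-real valued; it is finite, and a natural number, for vertices joined by a walk. The
  notions below are only meaningful for finite, connected, nonempty graphs.
\<close>

definition graph_dist :: "'a pair_pre_digraph \<Rightarrow> 'a \<Rightarrow> 'a \<Rightarrow> real" where
  "graph_dist G u v = real_of_ereal (wf_digraph.\<mu> (with_proj G) (\<lambda>_. 1) u v)"

definition ecc :: "'a pair_pre_digraph \<Rightarrow> 'a \<Rightarrow> real" where
  "ecc G u = Max (graph_dist G u ` pverts G)"

definition ecc_entry :: "'a pair_pre_digraph \<Rightarrow> 'a \<Rightarrow> 'a \<Rightarrow> real" where
  "ecc_entry G u v =
     (if graph_dist G u v = min (ecc G u) (ecc G v) then graph_dist G u v else 0)"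

text \<open>
  Library matrices are indexed by \<open>{0..<n}\<close>, so a matrix indexed by the vertices is written down
  along an enumeration of them. The characteristic polynomial, hence the spectrum, does not depend
  on the enumeration (lemma \<open>char_poly_ecc_matrix\<close>).
\<close>

definition matrix_along :: "'a list \<Rightarrow> ('a \<Rightarrow> 'a \<Rightarrow> 'b) \<Rightarrow> 'b mat" where
  "matrix_along vs f = mat (length vs) (length vs) (\<lambda>(i, j). f (vs ! i) (vs ! j))"

definition ecc_matrix :: "'a pair_pre_digraph \<Rightarrow> real mat" where
  "ecc_matrix G = matrix_along (SOME vs. distinct vs \<and> set vs = pverts G) (ecc_entry G)"

text \<open>
  All real eigenvalues in decreasing order, repeated according to algebraic multiplicity. The
  eccentricity matrix is symmetric, so these are all its eigenvalues.
\<close>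

definition eigenvalues_desc :: "real mat \<Rightarrow> real list" where
  "eigenvalues_desc A = rev (sorted_list_of_multiset (proots (char_poly A)))"

definition xi2 :: "'a pair_pre_digraph \<Rightarrow> real" where
  "xi2 G = eigenvalues_desc (ecc_matrix G) ! 1"

section \<open>Consistency of the encodings\<close>

lemma similar_matrix_along_perm:
  fixes f :: "'a \<Rightarrow> 'a \<Rightarrow> 'b :: field"
  assumes p: "p permutes {..<length vs}"
  shows "similar_mat (matrix_along (permute_list p vs) f) (matrix_along vs f)"
proof -
  let ?n = "length vs"
  let ?P = "mat ?n ?n (\<lambda>(i, j). if p i = j then 1 else 0) :: 'b mat"
  let ?Q = "mat ?n ?n (\<lambda>(i, j). if i = p j then 1 else 0) :: 'b mat"
  let ?A = "matrix_along vs f" and ?B = "matrix_along (permute_list p vs) f"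
  have pn: "p i < ?n" if "i < ?n" for i
    using permutes_in_image[OF p] that by auto
  have inj: "p i = p j \<longleftrightarrow> i = j" for i j
    using permutes_inj[OF p] by (auto dest: injD)
  have PQ: "?P * ?Q = 1\<^sub>m ?n"
    by (rule eq_matI) (auto simp: scalar_prod_def pn inj if_distrib[of "\<lambda>x. x * _"] cong: if_cong)
  have QP: "?Q * ?P = 1\<^sub>m ?n"
    by (rule mat_mult_left_right_inverse[of ?P ?n ?Q]) (auto simp: PQ)
  have PA: "?P * ?A = mat ?n ?n (\<lambda>(i, j). f (vs ! p i) (vs ! j))"
    by (rule eq_matI)
      (auto simp: scalar_prod_def matrix_along_def pn if_distrib[of "\<lambda>x. x * _"] cong: if_cong)
  have "?P * ?A * ?Q = ?B"
    unfolding PA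
    by (rule eq_matI)
      (auto simp: scalar_prod_def matrix_along_def pn permute_list_nth[OF p]
        if_distrib[of "\<lambda>x. _ * x"] cong: if_cong)
  with PQ QP have "similar_mat_wit ?B ?A ?P ?Q"
    by (auto simp: similar_mat_wit_def Let_def matrix_along_def)
  then show ?thesis
    unfolding similar_mat_def by blast
qed

lemma char_poly_ecc_matrix:
  assumes "distinct vs" "set vs = pverts G"
  shows "char_poly (ecc_matrix G) = char_poly (matrix_along vs (ecc_entry G))"
proof -
  define ws where "ws = (SOME vs. distinct vs \<and> set vs = pverts G)"
  have "distinct ws \<and> set ws = pverts G"
    unfolding ws_def by (rule someI[of _ vs]) (use assms in auto)
  then have "mset ws = mset vs"
    using assms by (simp add: set_eq_iff_mset_eq_distinct[symmetric])
  then obtain p where p: "p permutes {..<length vs}" "permute_list p vs = ws"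
    by (rule mset_eq_permutation)
  from similar_matrix_along_perm[OF p(1), of "ecc_entry G"] show ?thesis
    unfolding ecc_matrix_def ws_def[symmetric] p(2) by (rule char_poly_similar)
qed

lemma digraph_iso_iff:
  assumes "pair_graph G"
  shows "digraph_iso (with_proj G) (with_proj H) \<longleftrightarrow>
    (\<exists>f. inj_on f (pverts G) \<and> pverts H = f ` pverts G \<and> parcs H = map_prod f f ` parcs G)"
    (is "?L \<longleftrightarrow> ?R")
proof
  interpret G: pair_graph G by fact
  assume ?L
  then obtain h where h: "pre_digraph.digraph_isomorphism (with_proj G) h"
      "with_proj H = app_iso h (with_proj G)"
    unfolding digraph_iso_def by auto
  from h(2) have t: "iso_tail h = fst" "iso_head h = snd"
      and H: "pverts H = iso_verts h ` pverts G" "parcs H = iso_arcs h ` parcs G"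
    by (auto simp: with_proj_def app_iso_def)
  from h(1) have a: "iso_arcs h a = map_prod (iso_verts h) (iso_verts h) a" if "a \<in> parcs G" for a
    using that t by (auto simp: pre_digraph.digraph_isomorphism_def prod_eq_iff)
  have "parcs H = map_prod (iso_verts h) (iso_verts h) ` parcs G"
    unfolding H(2) by (rule image_cong) (auto simp: a)
  moreover have "inj_on (iso_verts h) (pverts G)"
    using h(1) by (auto simp: pre_digraph.digraph_isomorphism_def)
  ultimately show ?R
    using H(1) by blast
next
  interpret G: pair_graph G by fact
  assume ?R
  then obtain f where f: "inj_on f (pverts G)" "pverts H = f ` pverts G"
      "parcs H = map_prod f f ` parcs G"
    by blast
  let ?h = "\<lparr> iso_verts = f, iso_arcs = map_prod f f, iso_head = snd, iso_tail = fst \<rparr>"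
  have "inj_on (map_prod f f) (parcs G)"
    by (rule inj_on_subset[OF map_prod_inj_on[OF f(1) f(1)]]) (auto dest: G.wellformed')
  then have "pre_digraph.digraph_isomorphism (with_proj G) ?h"
    using f(1) G.wf_digraph_axioms by (auto simp: pre_digraph.digraph_isomorphism_def)
  moreover have "with_proj H = app_iso ?h (with_proj G)"
    using f by (simp add: with_proj_def app_iso_def)
  ultimately show ?L
    unfolding digraph_iso_def by blast
qed

lemma graph_dist_eq_Least:
  assumes "pair_graph G" "u \<rightarrow>\<^sup>*\<^bsub>with_proj G\<^esub> v"
  shows "graph_dist G u v =
    real (LEAST k. \<exists>p. pre_digraph.awalk (with_proj G) u p v \<and> length p = k)"
proof -
  interpret G: pair_graph G by fact
  let ?P = "\<lambda>k. \<exists>p. G.awalk u p v \<and> length p = k"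
  have cost: "G.awalk_cost (\<lambda>_. 1) p = real (length p)" for p
    by (induction p) auto
  obtain q where "G.awalk u q v"
    using assms(2) G.reachable_awalk by auto
  then have "\<exists>k. ?P k"
    by blast
  from LeastI_ex[OF this] have "?P (LEAST k. ?P k)" .
  then obtain p where p: "G.awalk u p v" "length p = (LEAST k. ?P k)"
    by blast
  have "G.\<mu> (\<lambda>_. 1) u v = ereal (real (length p))"
    unfolding G.\<mu>_def cost
  proof (rule antisym)
    show "(INF q\<in>{q. G.awalk u q v}. ereal (real (length q))) \<le> ereal (real (length p))"
      using p(1) by (intro INF_lower) simp
    show "ereal (real (length p)) \<le> (INF q\<in>{q. G.awalk u q v}. ereal (real (length q)))"
      unfolding p(2) by (intro INF_greatest) (auto intro!: Least_le)
  qed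
  with p(2) show ?thesis
    by (simp add: graph_dist_def)
qed

lemma pair_graph_compl_graph: "pair_graph G \<Longrightarrow> pair_graph (compl_graph G)"
proof -
  assume "pair_graph G"
  then interpret G: pair_graph G .
  have "parcs (compl_graph G) \<subseteq> pverts G \<times> pverts G"
    by (auto simp: compl_graph_def)
  then have "finite (parcs (compl_graph G))"
    using G.pair_finite_verts by (meson finite_SigmaI finite_subset)
  moreover have "sym (parcs G)"
    using G.pair_sym_arcs by (simp add: symmetric_def)
  ultimately show ?thesis
    using G.pair_finite_verts
    by unfold_locales (auto simp: compl_graph_def symmetric_def sym_def)
qed

end

theory Submission
  imports Defs "Jordan_Normal_Form.Schur_Decomposition"
begin

text \<open>
  Call an edge of \<open>T\<close> dominating if every vertex is adjacent to one of its ends. If \<open>T\<close> has no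
  dominating edge, then all eccentricities in \<open>T\<^sup>c\<close> are 2 and the eccentricity matrix of \<open>T\<^sup>c\<close> is twice
  the adjacency matrix of \<open>T\<close>; moreover \<open>T\<close> contains two independent edges without an edge between
  them, and the two indicator vectors of these edges span a plane on which the quadratic form is at
  least \<open>2 |x|\<^sup>2\<close>, so \<open>\<xi>\<^sub>2 \<ge> 2\<close>. Otherwise \<open>T\<close> is a double star with \<open>a, b \<ge> 1\<close> leaves at its two
  centres; the entry of the two centres is 3, that of a leaf and its centre is 2, and the positive
  eigenvalues \<open>e\<close> are the solutions of \<open>(e\<^sup>2 - 4 a) (e\<^sup>2 - 4 b) = 9 e\<^sup>2\<close>. The smaller one increases with
  \<open>a b\<close>, which is least exactly if \<open>a = 1\<close> or \<open>b = 1\<close>, and for this value it is less than 2.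
\<close>

section \<open>Spectral theory of real symmetric matrices\<close>

text \<open>Over the complex numbers the characteristic polynomial splits, so there is an
  eigenvector \<open>v\<close>. Because \<open>A\<close> is real and symmetric, the Hermitian form
  \<open>Q\<close> of \<open>v\<close> equals its own conjugate; it is also \<open>e\<close> times
  the squared norm \<open>S\<close> of \<open>v\<close>, which is nonzero. Hence \<open>e\<close> is
  real.\<close>

lemma symmetric_mat_eigenvalue_exists:
  fixes A :: "real mat"
  assumes A: "A \<in> carrier_mat n n" and sym: "A\<^sup>T = A" and n: "n > 0"
  shows "\<exists>e. eigenvalue A e"
proof -
  let ?C = "map_mat complex_of_real A"
  have C: "?C \<in> carrier_mat n n"
    using A by auto
  obtain as where as: "char_poly ?C = (\<Prod>a\<leftarrow>as. [:- a, 1:])" "length as = n"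
    using char_poly_factorized[OF C] by blast
  then obtain e as' where "as = e # as'"
    using n by (cases as) auto
  with as have "poly (char_poly ?C) e = 0"
    by simp
  then have "eigenvalue ?C e"
    using eigenvalue_root_char_poly[OF C] by simp
  then obtain v where v: "v \<in> carrier_vec n" "v \<noteq> 0\<^sub>v n" "?C *\<^sub>v v = e \<cdot>\<^sub>v v"
    using C unfolding eigenvalue_def eigenvector_def by auto
  have symA: "A $$ (i, j) = A $$ (j, i)" if "i < n" "j < n" for i j
    using that A sym by (metis carrier_matD index_transpose_mat(1))
  have Cv: "(\<Sum>j<n. of_real (A $$ (i, j)) * v $ j) = e * v $ i" if "i < n" for i
  proof -
    have "(?C *\<^sub>v v) $ i = (\<Sum>j<n. of_real (A $$ (i, j)) * v $ j)"
      using that A v(1) by (auto simp: scalar_prod_def lessThan_atLeast0)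
    then show ?thesis
      using that v by simp
  qed
  define S where "S = (\<Sum>i<n. (cmod (v $ i))\<^sup>2)"
  define Q where "Q = (\<Sum>i<n. \<Sum>j<n. of_real (A $$ (i, j)) * v $ j * cnj (v $ i))"
  have "S \<noteq> 0"
  proof
    assume "S = 0"
    then have "\<forall>i<n. v $ i = 0"
      unfolding S_def by (subst (asm) sum_nonneg_eq_0_iff) auto
    then have "v = 0\<^sub>v n"
      using v(1) by (intro eq_vecI) auto
    with v(2) show False
      by simp
  qed
  have "Q = (\<Sum>i<n. (e * v $ i) * cnj (v $ i))"
    unfolding Q_def by (intro sum.cong) (auto simp: Cv sum_distrib_right[symmetric])
  also have "\<dots> = e * of_real S"
    unfolding S_def of_real_sum sum_distrib_left
    by (intro sum.cong) (simp_all add: complex_norm_square mult.assoc del: of_real_power)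
  finally have Q: "Q = e * of_real S" .
  have "cnj Q = (\<Sum>i<n. \<Sum>j<n. of_real (A $$ (i, j)) * cnj (v $ j) * v $ i)"
    unfolding Q_def by simp
  also have "\<dots> = (\<Sum>j<n. \<Sum>i<n. of_real (A $$ (i, j)) * cnj (v $ j) * v $ i)"
    by (rule sum.swap)
  also have "\<dots> = Q"
    unfolding Q_def using symA by (intro sum.cong) auto
  finally have "cnj e = e"
    using \<open>S \<noteq> 0\<close> unfolding Q by simp
  then obtain r where r: "e = of_real r"
    by (metis Reals_cnj_iff Reals_cases)
  have "poly (char_poly ?C) e = of_real (poly (char_poly A) r)"
    unfolding r by (subst of_real_hom.char_poly_hom[OF A]) simp
  then have "poly (char_poly A) r = 0"
    using \<open>poly (char_poly ?C) e = 0\<close> by simp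
  then show ?thesis
    using eigenvalue_root_char_poly[OF A] by blast
qed

text \<open>Complete \<open>v\<close> to a basis, apply Gram-Schmidt, which keeps the first vector,
  and normalise. The factor \<open>k\<close> comes from the normalisation.\<close>

lemma orthogonal_mat_with_first_column:
  fixes v :: "real vec"
  assumes v: "v \<in> carrier_vec n" "v \<noteq> 0\<^sub>v n"
  obtains W k where "W \<in> carrier_mat n n" "W\<^sup>T * W = 1\<^sub>m n" "col W 0 = k \<cdot>\<^sub>v v"
proof -
  interpret cof_vec_space n "TYPE(real)" .
  define b where "b = basis_completion v"
  define ws where "ws = gram_schmidt n b"
  note bc = basis_completion[OF v, folded b_def]
  have n: "n > 0"
    using v by (cases n) auto
  from bc obtain vs where bv: "b = v # vs"
    using n by (cases b) auto
  note gs = gram_schmidt_result[OF bc(2,4,5) refl, folded ws_def]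
  have len: "length ws = n"
    using gs(4) bc(6) by simp
  have w0: "ws ! 0 = v"
    using gram_schmidt_hd[OF v(1), of vs] len n
    by (simp add: hd_conv_nth[symmetric] ws_def bv flip: length_greater_0_conv)
  have ws: "ws ! i \<in> carrier_vec n" if "i < n" for i
    using gs(3) len that by (meson nth_mem subsetD)
  have orth: "ws ! i \<bullet> ws ! j = 0 \<longleftrightarrow> i \<noteq> j" if "i < n" "j < n" for i j
    using corthogonalD[OF gs(2)] that len by (simp add: conjugate_vec_def conjugate_real_def)
  define c where "c i = 1 / sqrt (ws ! i \<bullet> ws ! i)" for i
  define W where "W = mat_of_cols n (map (\<lambda>i. c i \<cdot>\<^sub>v ws ! i) [0..<n])"
  have colW: "col W i = c i \<cdot>\<^sub>v ws ! i" if "i < n" for i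
    unfolding W_def using that ws[OF that] by (subst col_mat_of_cols) auto
  have W: "W \<in> carrier_mat n n"
    unfolding W_def by (auto simp: mat_of_cols_def)
  have "ws ! i \<bullet> ws ! i \<ge> 0" if "i < n" for i
    using ws[OF that] by (auto simp: scalar_prod_def intro: sum_nonneg)
  then have "c i * c i * (ws ! i \<bullet> ws ! i) = 1" if "i < n" for i
    using orth[OF that that] that by (simp add: c_def)
  then have "W\<^sup>T * W = 1\<^sub>m n"
    using W ws
    by (intro eq_matI)
      (auto simp: colW orth mult.assoc smult_scalar_prod_distrib[of _ n] scalar_prod_smult_distrib[of _ n])
  moreover have "col W 0 = c 0 \<cdot>\<^sub>v v"
    using colW n w0 by simp
  ultimately show thesis
    using that W by blast
qed

text \<open>Deflation: conjugation by an orthogonal matrix whose first column is an eigenvector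
  splits off a 1 by 1 block, and the induction hypothesis diagonalises the rest. The factorised
  characteristic polynomial is carried along because \<open>xi2\<close> counts eigenvalues by
  algebraic multiplicity.\<close>

lemma spectral_theorem_symmetric_mat:
  fixes A :: "real mat"
  assumes "A \<in> carrier_mat n n" "A\<^sup>T = A"
  shows "\<exists>P es. P \<in> carrier_mat n n \<and> P\<^sup>T * P = 1\<^sub>m n \<and> length es = n \<and>
    char_poly A = (\<Prod>e\<leftarrow>es. [:- e, 1:]) \<and>
    P\<^sup>T * A * P = mat n n (\<lambda>(i, j). if i = j then es ! i else 0)"
  using assms
proof (induction n arbitrary: A)
  case 0
  then have "char_poly A = 1"
    by (simp add: char_poly_defs det_def)
  with 0 show ?case
    by (intro exI[of _ "1\<^sub>m 0"] exI[of _ "[]"]) auto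
next
  case (Suc m)
  let ?n = "Suc m"
  note A = Suc.prems(1)
  obtain e v where ev: "v \<in> carrier_vec ?n" "v \<noteq> 0\<^sub>v ?n" "A *\<^sub>v v = e \<cdot>\<^sub>v v"
    using symmetric_mat_eigenvalue_exists[OF Suc.prems] A
    unfolding eigenvalue_def eigenvector_def by auto
  obtain W k where W: "W \<in> carrier_mat ?n ?n" "W\<^sup>T * W = 1\<^sub>m ?n" "col W 0 = k \<cdot>\<^sub>v v"
    using orthogonal_mat_with_first_column[OF ev(1,2)] by blast
  have WT: "W\<^sup>T \<in> carrier_mat ?n ?n"
    using W by auto
  have colW: "col W 0 \<in> carrier_vec ?n"
    unfolding W(3) using ev(1) by simp
  have WWT: "W * W\<^sup>T = 1\<^sub>m ?n"
    using mat_mult_left_right_inverse[OF WT W(1,2)] .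
  define A' where "A' = W\<^sup>T * A * W"
  have A': "A' \<in> carrier_mat ?n ?n"
    unfolding A'_def using A W by auto
  have symA': "A'\<^sup>T = A'"
    unfolding A'_def using A W WT Suc.prems(2)
    by (simp add: transpose_mult[of _ ?n ?n _ ?n] assoc_mult_mat[of _ ?n ?n _ ?n _ ?n])
  have "similar_mat_wit A' A (W\<^sup>T) W"
    using A W WT WWT A' by (intro similar_mat_witI[of _ _ ?n]) (auto simp: A'_def)
  then have cp: "char_poly A' = char_poly A"
    by (intro char_poly_similar) (auto simp: similar_mat_def)
  \<comment> \<open>The first column of \<open>W\<close> is an eigenvector of \<open>A\<close>, and
    by orthonormality \<open>W\<^sup>T\<close> sends it to the first unit vector.\<close>
  have "col A' 0 = e \<cdot>\<^sub>v unit_vec ?n 0"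
  proof -
    have "col A' 0 = (W\<^sup>T * A) *\<^sub>v col W 0"
      unfolding A'_def using A W(1) WT by (intro col_mult2[of _ ?n ?n _ ?n]) auto
    also have "\<dots> = W\<^sup>T *\<^sub>v (A *\<^sub>v col W 0)"
      using A W(1) WT colW by (intro assoc_mult_mat_vec[of _ ?n ?n _ ?n]) auto
    also have "A *\<^sub>v col W 0 = e \<cdot>\<^sub>v col W 0"
      unfolding W(3) using A ev
      by (simp add: mult_mat_vec[of _ ?n ?n] smult_smult_assoc mult.commute)
    also have "W\<^sup>T *\<^sub>v (e \<cdot>\<^sub>v col W 0) = e \<cdot>\<^sub>v (W\<^sup>T *\<^sub>v col W 0)"
      using W(1) WT colW by (intro mult_mat_vec[of _ ?n ?n]) auto
    also have "W\<^sup>T *\<^sub>v col W 0 = col (W\<^sup>T * W) 0"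
      using W(1) WT by (intro col_mult2[symmetric, of _ ?n ?n _ ?n]) auto
    also have "\<dots> = unit_vec ?n 0"
      unfolding W(2) by simp
    finally show ?thesis .
  qed
  then have c0: "A' $$ (i, 0) = (if i = 0 then e else 0)" if "i < ?n" for i
    using that A' by (metis (no_types) carrier_matD index_col index_smult_vec(1) index_unit_vec(1,3)
      mult_1_right mult_zero_right zero_less_Suc)
  \<comment> \<open>Symmetry of \<open>A'\<close> carries the zeros of the first column over to the
    first row.\<close>
  then have r0: "A' $$ (0, i) = (if i = 0 then e else 0)" if "i < ?n" for i
    using that A' symA' by (metis carrier_matD index_transpose_mat(1) zero_less_Suc)
  define A3 where "A3 = mat m m (\<lambda>(i, j). A' $$ (Suc i, Suc j))"
  define E where "E = mat 1 1 (\<lambda>_. e)"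
  have A3: "A3 \<in> carrier_mat m m" and E: "E \<in> carrier_mat 1 1"
    by (auto simp: A3_def E_def)
  have block: "A' = four_block_mat E (0\<^sub>m 1 m) (0\<^sub>m m 1) A3"
    using A' c0 r0 by (intro eq_matI) (auto simp: A3_def E_def)
  have "A3\<^sup>T = A3"
  proof (rule eq_matI)
    fix i j assume "i < dim_row A3" "j < dim_col A3"
    then show "A3\<^sup>T $$ (i, j) = A3 $$ (i, j)"
      using A' arg_cong[OF symA', of "\<lambda>B. B $$ (Suc i, Suc j)"] by (auto simp: A3_def)
  qed (auto simp: A3_def)
  from Suc.IH[OF A3 this] obtain P3 es where
    IH: "P3 \<in> carrier_mat m m" "P3\<^sup>T * P3 = 1\<^sub>m m" "length es = m"
      "char_poly A3 = (\<Prod>e\<leftarrow>es. [:- e, 1:])"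
      "P3\<^sup>T * A3 * P3 = mat m m (\<lambda>(i, j). if i = j then es ! i else 0)"
    by blast
  \<comment> \<open>\<open>F\<close> fixes the split-off coordinate and diagonalises the remaining
    block, so \<open>W * F\<close> diagonalises \<open>A\<close>.\<close>
  define F where "F = four_block_mat (1\<^sub>m 1) (0\<^sub>m 1 m) (0\<^sub>m m 1) P3"
  have F: "F \<in> carrier_mat ?n ?n" and FT: "F\<^sup>T \<in> carrier_mat ?n ?n"
    using IH(1) by (auto simp: F_def)
  have FT_block: "F\<^sup>T = four_block_mat (1\<^sub>m 1) (0\<^sub>m 1 m) (0\<^sub>m m 1) P3\<^sup>T"
    using IH(1) by (auto simp: F_def transpose_four_block_mat[of _ 1 1 _ m _ m])
  have "F\<^sup>T * F = four_block_mat (1\<^sub>m 1) (0\<^sub>m 1 m) (0\<^sub>m m 1) (P3\<^sup>T * P3)"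
    unfolding FT_block unfolding F_def using IH(1)
    by (subst mult_four_block_mat[of _ 1 1 _ m _ m _ _ 1 _ m]) auto
  then have FF: "F\<^sup>T * F = 1\<^sub>m ?n"
    using IH(2) four_block_one_mat[of 1 m] by simp
  have "F\<^sup>T * A' * F = four_block_mat E (0\<^sub>m 1 m) (0\<^sub>m m 1) (P3\<^sup>T * A3 * P3)"
    unfolding FT_block block unfolding F_def using IH(1) A3 E
    by (simp add: mult_four_block_mat[of _ 1 1 _ m _ m _ _ 1 _ m])
  also have "\<dots> = mat ?n ?n (\<lambda>(i, j). if i = j then (e # es) ! i else 0)"
    unfolding IH(5) by (intro eq_matI) (auto simp: E_def)
  finally have FAF: "F\<^sup>T * A' * F = mat ?n ?n (\<lambda>(i, j). if i = j then (e # es) ! i else 0)" .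
  define P where "P = W * F"
  have P: "P \<in> carrier_mat ?n ?n"
    using W F by (auto simp: P_def)
  have PT: "P\<^sup>T = F\<^sup>T * W\<^sup>T"
    unfolding P_def using W F by (intro transpose_mult) auto
  have "P\<^sup>T * P = F\<^sup>T * (W\<^sup>T * W) * F"
    unfolding PT unfolding P_def using W(1) WT F FT
    by (simp add: assoc_mult_mat[of _ ?n ?n _ ?n _ ?n])
  then have "P\<^sup>T * P = 1\<^sub>m ?n"
    unfolding W(2) using FF F FT by simp
  moreover have "P\<^sup>T * A * P = F\<^sup>T * A' * F"
    unfolding PT A'_def unfolding P_def using W(1) WT F FT A
    by (simp add: assoc_mult_mat[of _ ?n ?n _ ?n _ ?n])
  moreover have "char_poly A = (\<Prod>e\<leftarrow>e # es. [:- e, 1:])"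
  proof -
    have "char_poly A' = char_poly E * char_poly A3"
      unfolding block using E A3 by (intro char_poly_four_block_zeros_col) auto
    moreover have "char_poly E = [:- e, 1:]"
      by (simp add: E_def char_poly_defs det_def sign_def)
    ultimately show ?thesis
      using cp IH(4) by simp
  qed
  ultimately show ?case
    using P IH(3) FAF by (intro exI[of _ P] exI[of _ "e # es"]) simp
qed

section \<open>The decreasing list of eigenvalues and criteria for its second entry\<close>

lemma eigenvalues_desc_of_roots:
  assumes "char_poly A = (\<Prod>e\<leftarrow>es. [:- e, 1:])"
  shows "mset (eigenvalues_desc A) = mset es"
proof -
  have "proots (\<Prod>e\<leftarrow>es. [:- e, 1:]) = mset es" for es :: "real list"
  proof (induction es)
    case (Cons e es)
    have "(\<Prod>e\<leftarrow>es. [:- e, 1:]) \<noteq> 0"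
      by (simp add: prod_list_zero_iff image_iff)
    then have "proots ([:- e, 1:] * (\<Prod>e\<leftarrow>es. [:- e, 1:])) = add_mset e (mset es)"
      using Cons by (subst proots_mult) (simp_all del: mult_pCons_left)
    then show ?case
      by (simp del: mult_pCons_left)
  qed simp
  then show ?thesis
    unfolding eigenvalues_desc_def assms by simp
qed

lemma eigenvalues_desc_mono:
  assumes "i \<le> j" "j < length (eigenvalues_desc A)"
  shows "eigenvalues_desc A ! j \<le> eigenvalues_desc A ! i"
  using assms unfolding eigenvalues_desc_def
  by (simp add: rev_nth sorted_nth_mono)

text \<open>The spectral theorem with vectors as functions on the vertices, numbered so that
  \<open>x i\<close> belongs to the \<open>i\<close>-th entry of the decreasing list. The first sum
  rule is orthonormality of the columns of \<open>P\<close>, the second is orthonormality of its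
  rows and serves to expand functions in the basis.\<close>

lemma symmetric_matrix_along_eigenbasis:
  fixes f :: "'a \<Rightarrow> 'a \<Rightarrow> real"
  assumes vs: "distinct vs"
    and sym: "\<And>u v. u \<in> set vs \<Longrightarrow> v \<in> set vs \<Longrightarrow> f u v = f v u"
  defines "es \<equiv> eigenvalues_desc (matrix_along vs f)"
  obtains x where "length es = length vs"
    "\<And>i j. i < length vs \<Longrightarrow> j < length vs \<Longrightarrow>
      (\<Sum>v\<in>set vs. x i v * x j v) = (if i = j then 1 else 0)"
    "\<And>u v. u \<in> set vs \<Longrightarrow> v \<in> set vs \<Longrightarrow>
      (\<Sum>i<length vs. x i u * x i v) = (if u = v then 1 else 0)"
    "\<And>i u. i < length vs \<Longrightarrow> u \<in> set vs \<Longrightarrow> (\<Sum>v\<in>set vs. f u v * x i v) = es ! i * x i u"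
proof -
  define n where "n = length vs"
  let ?A = "matrix_along vs f"
  have A: "?A \<in> carrier_mat n n"
    by (simp add: matrix_along_def n_def)
  have "?A\<^sup>T = ?A"
    using sym by (intro eq_matI) (auto simp: matrix_along_def)
  from spectral_theorem_symmetric_mat[OF A this] obtain P ds where
    P: "P \<in> carrier_mat n n" "P\<^sup>T * P = 1\<^sub>m n" and ds: "length ds = n"
      "char_poly ?A = (\<Prod>e\<leftarrow>ds. [:- e, 1:])"
    and diag: "P\<^sup>T * ?A * P = mat n n (\<lambda>(i, j). if i = j then ds ! i else 0)"
    by blast
  have PT: "P\<^sup>T \<in> carrier_mat n n"
    using P by auto
  have PPT: "P * P\<^sup>T = 1\<^sub>m n"
    using mat_mult_left_right_inverse[OF PT P] .
  \<comment> \<open>The diagonal \<open>ds\<close> comes in arbitrary order; \<open>p\<close>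
    rearranges it into the decreasing list.\<close>
  obtain p where p: "p permutes {..<n}" "permute_list p ds = es"
    using mset_eq_permutation[OF eigenvalues_desc_of_roots[OF ds(2)]] ds(1) es_def by auto
  have pn: "p i < n" if "i < n" for i
    using permutes_in_image[OF p(1)] that by auto
  have pinj: "p i = p j \<longleftrightarrow> i = j" for i j
    using permutes_inj[OF p(1)] by (auto dest: injD)
  have len: "length es = n"
    using p(2) ds(1) by auto
  have es_nth: "es ! i = ds ! p i" if "i < n" for i
    using permute_list_nth[of p ds i] p ds(1) that by auto
  have AP: "?A * P = P * mat n n (\<lambda>(i, j). if i = j then ds ! i else 0)"
  proof -
    have "P * (P\<^sup>T * ?A * P) = (P * P\<^sup>T) * ?A * P"
      using P(1) PT A by (simp add: assoc_mult_mat[of _ n n _ n _ n])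
    then show ?thesis
      using P(1) A unfolding diag PPT by simp
  qed
  define pos where "pos u = (THE k. k < n \<and> vs ! k = u)" for u
  have pos_nth: "pos (vs ! k) = k" if "k < n" for k
    unfolding pos_def using that vs by (intro the_equality) (auto simp: n_def nth_eq_iff_index_eq)
  define x where "x i u = P $$ (pos u, p i)" for i u
  have reindex: "(\<Sum>v\<in>set vs. g v) = (\<Sum>k<n. g (vs ! k))" for g :: "'a \<Rightarrow> real"
    using sum.reindex_bij_betw[OF bij_betw_nth[OF vs refl refl], of g] by (simp add: n_def)
  have 1: "(\<Sum>v\<in>set vs. x i v * x j v) = (if i = j then 1 else 0)" if "i < n" "j < n" for i j
  proof -
    have "(\<Sum>v\<in>set vs. x i v * x j v) = (P\<^sup>T * P) $$ (p i, p j)"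
      unfolding reindex x_def using P(1) that pn
      by (auto simp: pos_nth scalar_prod_def lessThan_atLeast0 intro!: sum.cong)
    then show ?thesis
      unfolding P(2) using that pn pinj by simp
  qed
  have 2: "(\<Sum>i<n. x i u * x i v) = (if u = v then 1 else 0)" if uv: "u \<in> set vs" "v \<in> set vs" for u v
  proof -
    obtain k l where kl: "k < n" "l < n" "u = vs ! k" "v = vs ! l"
      using uv by (auto simp: in_set_conv_nth n_def)
    have "(\<Sum>i<n. x i u * x i v) = (\<Sum>i<n. P $$ (k, p i) * P $$ (l, p i))"
      using kl by (simp add: x_def pos_nth)
    also have "\<dots> = (\<Sum>i<n. P $$ (k, i) * P $$ (l, i))"
      using sum.permute[OF p(1), of "\<lambda>i. P $$ (k, i) * P $$ (l, i)"] by (simp add: o_def)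
    also have "\<dots> = (P * P\<^sup>T) $$ (k, l)"
      using P(1) kl by (auto simp: scalar_prod_def lessThan_atLeast0 intro!: sum.cong)
    also have "\<dots> = (if u = v then 1 else 0)"
      unfolding PPT using kl vs by (simp add: nth_eq_iff_index_eq n_def)
    finally show ?thesis .
  qed
  have 3: "(\<Sum>v\<in>set vs. f u v * x i v) = es ! i * x i u" if iu: "i < n" "u \<in> set vs" for i u
  proof -
    obtain k where k: "k < n" "u = vs ! k"
      using iu by (auto simp: in_set_conv_nth n_def)
    have "(\<Sum>v\<in>set vs. f u v * x i v) = (?A * P) $$ (k, p i)"
      unfolding reindex x_def using P(1) A k iu pn
      by (auto simp: pos_nth scalar_prod_def lessThan_atLeast0 matrix_along_def n_def intro!: sum.cong)
    also have "\<dots> = P $$ (k, p i) * ds ! p i"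
      unfolding AP using P(1) k iu pn
      by (simp add: scalar_prod_def if_distrib[of "\<lambda>x. _ * x"] cong: if_cong)
    finally show ?thesis
      using k iu by (simp add: es_nth x_def pos_nth)
  qed
  show thesis
    using that[of x] len 1 2 3 unfolding n_def by blast
qed

text \<open>One half of the Courant-Fischer principle: the plane spanned by \<open>y\<close> and
  \<open>z\<close> contains a nonzero \<open>w\<close> orthogonal to the top eigenfunction
  \<open>x 0\<close>. On \<open>w\<close> the form is at least \<open>c\<close> and at most
  \<open>es ! 1\<close> times the squared norm.\<close>

lemma second_eigenvalue_ge:
  fixes f :: "'a \<Rightarrow> 'a \<Rightarrow> real"
  assumes vs: "distinct vs" "length vs \<ge> 2"
    and sym: "\<And>u v. u \<in> set vs \<Longrightarrow> v \<in> set vs \<Longrightarrow> f u v = f v u"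
    and indep: "\<And>s t. (\<forall>v\<in>set vs. s * y v + t * z v = 0) \<Longrightarrow> s = 0 \<and> t = 0"
    and form: "\<And>s t. c * (\<Sum>v\<in>set vs. (s * y v + t * z v)\<^sup>2) \<le>
      (\<Sum>u\<in>set vs. \<Sum>v\<in>set vs. f u v * (s * y u + t * z u) * (s * y v + t * z v))"
  shows "c \<le> eigenvalues_desc (matrix_along vs f) ! 1"
proof -
  let ?V = "set vs" and ?n = "length vs"
  define es where "es = eigenvalues_desc (matrix_along vs f)"
  obtain x where len: "length es = ?n"
    and orth: "\<And>i j. i < ?n \<Longrightarrow> j < ?n \<Longrightarrow> (\<Sum>v\<in>?V. x i v * x j v) = (if i = j then 1 else 0)"
    and compl: "\<And>u v. u \<in> ?V \<Longrightarrow> v \<in> ?V \<Longrightarrow> (\<Sum>i<?n. x i u * x i v) = (if u = v then 1 else 0)"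
    and eig: "\<And>i u. i < ?n \<Longrightarrow> u \<in> ?V \<Longrightarrow> (\<Sum>v\<in>?V. f u v * x i v) = es ! i * x i u"
    by (rule symmetric_matrix_along_eigenbasis[where f = f, OF vs(1) sym, folded es_def]) (assumption | rule that)+
  define p q where "p = (\<Sum>v\<in>?V. y v * x 0 v)" and "q = (\<Sum>v\<in>?V. z v * x 0 v)"
  \<comment> \<open>One linear condition in two unknowns: \<open>(q, -p)\<close> solves it, and if
    \<open>p\<close> and \<open>q\<close> both vanish then \<open>(1, 0)\<close> does.\<close>
  obtain s t where st: "s * p + t * q = 0" "\<not> (s = 0 \<and> t = 0)"
    by (cases "p = 0 \<and> q = 0") (use that[of 1 0] that[of q "-p"] in auto)
  define w where "w v = s * y v + t * z v" for v
  define a where "a i = (\<Sum>v\<in>?V. w v * x i v)" for i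
  have "a 0 = s * p + t * q"
    unfolding a_def w_def p_def q_def by (simp add: sum_distrib_left sum.distrib algebra_simps)
  then have a0: "a 0 = 0"
    using st by simp
  have expand: "w v = (\<Sum>i<?n. a i * x i v)" if "v \<in> ?V" for v
  proof -
    have "(\<Sum>i<?n. a i * x i v) = (\<Sum>i<?n. \<Sum>u\<in>?V. w u * (x i u * x i v))"
      unfolding a_def by (simp add: sum_distrib_right mult.assoc)
    also have "\<dots> = (\<Sum>u\<in>?V. w u * (\<Sum>i<?n. x i u * x i v))"
      by (subst sum.swap) (simp add: sum_distrib_left)
    also have "\<dots> = w v"
      using that by (simp add: compl if_distrib[of "\<lambda>x. _ * x"] cong: if_cong)
    finally show ?thesis ..
  qed
  \<comment> \<open>Parseval's identity; \<open>quad\<close> is its counterpart for the quadratic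
    form, which is diagonal in the coordinates \<open>a i\<close>.\<close>
  have norm: "(\<Sum>v\<in>?V. (w v)\<^sup>2) = (\<Sum>i<?n. (a i)\<^sup>2)"
  proof -
    have "(\<Sum>v\<in>?V. (w v)\<^sup>2) = (\<Sum>v\<in>?V. w v * (\<Sum>i<?n. a i * x i v))"
      by (intro sum.cong) (simp_all add: power2_eq_square expand)
    also have "\<dots> = (\<Sum>v\<in>?V. \<Sum>i<?n. a i * (w v * x i v))"
      by (simp add: sum_distrib_left algebra_simps)
    also have "\<dots> = (\<Sum>i<?n. a i * a i)"
      by (subst sum.swap) (simp add: sum_distrib_left a_def)
    finally show ?thesis
      by (simp add: power2_eq_square)
  qed
  have quad: "(\<Sum>u\<in>?V. \<Sum>v\<in>?V. f u v * w u * w v) = (\<Sum>i<?n. es ! i * (a i)\<^sup>2)"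
  proof -
    have fw: "(\<Sum>v\<in>?V. f u v * w v) = (\<Sum>i<?n. a i * (es ! i * x i u))" if "u \<in> ?V" for u
    proof -
      have "(\<Sum>v\<in>?V. f u v * w v) = (\<Sum>v\<in>?V. \<Sum>i<?n. a i * (f u v * x i v))"
        by (intro sum.cong) (simp_all add: expand sum_distrib_left algebra_simps)
      also have "\<dots> = (\<Sum>i<?n. a i * (es ! i * x i u))"
        by (subst sum.swap) (simp add: sum_distrib_left[symmetric] eig that)
      finally show ?thesis .
    qed
    have "(\<Sum>u\<in>?V. \<Sum>v\<in>?V. f u v * w u * w v) = (\<Sum>u\<in>?V. w u * (\<Sum>v\<in>?V. f u v * w v))"
      by (simp add: sum_distrib_left algebra_simps)
    also have "\<dots> = (\<Sum>u\<in>?V. \<Sum>i<?n. es ! i * a i * (w u * x i u))"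
      by (intro sum.cong refl) (simp only: fw, simp add: sum_distrib_left mult_ac)
    also have "\<dots> = (\<Sum>i<?n. es ! i * a i * a i)"
      by (subst sum.swap) (simp add: sum_distrib_left[symmetric] flip: a_def)
    finally show ?thesis
      by (simp add: power2_eq_square algebra_simps)
  qed
  have "c * (\<Sum>i<?n. (a i)\<^sup>2) \<le> (\<Sum>i<?n. es ! i * (a i)\<^sup>2)"
    using form[of s t] unfolding w_def[symmetric] norm quad .
  \<comment> \<open>The largest eigenvalue drops out because \<open>a 0 = 0\<close>; all others are
    at most \<open>es ! 1\<close>.\<close>
  also have "\<dots> \<le> (\<Sum>i<?n. es ! 1 * (a i)\<^sup>2)"
  proof (rule sum_mono)
    fix i assume i: "i \<in> {..<?n}"
    show "es ! i * (a i)\<^sup>2 \<le> es ! 1 * (a i)\<^sup>2"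
      using eigenvalues_desc_mono[of 1 i] i len
      by (cases "i = 0") (auto simp: a0 es_def intro!: mult_right_mono)
  qed
  finally have "c * (\<Sum>i<?n. (a i)\<^sup>2) \<le> es ! 1 * (\<Sum>i<?n. (a i)\<^sup>2)"
    by (simp add: sum_distrib_left)
  moreover obtain v where "v \<in> ?V" "w v \<noteq> 0"
    using indep[of s t] st(2) unfolding w_def by blast
  then have "(\<Sum>i<?n. (a i)\<^sup>2) > 0"
    unfolding norm[symmetric] by (intro sum_pos2) auto
  ultimately show ?thesis
    unfolding es_def by simp
qed

text \<open>The list starts with \<open>l, c\<close>: both values occur in it, nothing else exceeds
  \<open>c\<close>, and \<open>l\<close> occurs only once because an eigenfunction for
  \<open>l\<close> is determined by its value at \<open>u\<close>. As \<open>eigvec\<close> admits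
  the zero function, nonvanishing is demanded separately.\<close>

lemma second_eigenvalue_eq:
  fixes f :: "'a \<Rightarrow> 'a \<Rightarrow> real"
  assumes vs: "distinct vs"
    and sym: "\<And>u v. u \<in> set vs \<Longrightarrow> v \<in> set vs \<Longrightarrow> f u v = f v u"
  defines "eigvec e y \<equiv> \<forall>v\<in>set vs. (\<Sum>w\<in>set vs. f v w * y w) = e * y v"
  assumes "c < l"
    and y: "eigvec l y" "v \<in> set vs" "y v \<noteq> 0"
    and z: "eigvec c z" "w \<in> set vs" "z w \<noteq> 0"
    and simple: "u \<in> set vs" "\<And>y. eigvec l y \<Longrightarrow> y u = 0 \<Longrightarrow> \<forall>v\<in>set vs. y v = 0"
    and only: "\<And>e y v. eigvec e y \<Longrightarrow> v \<in> set vs \<Longrightarrow> y v \<noteq> 0 \<Longrightarrow> e > c \<Longrightarrow> e = l"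
  shows "eigenvalues_desc (matrix_along vs f) ! 1 = c"
proof -
  let ?V = "set vs" and ?n = "length vs"
  define es where "es = eigenvalues_desc (matrix_along vs f)"
  obtain x where len: "length es = ?n"
    and orth: "\<And>i j. i < ?n \<Longrightarrow> j < ?n \<Longrightarrow> (\<Sum>v\<in>?V. x i v * x j v) = (if i = j then 1 else 0)"
    and compl: "\<And>u v. u \<in> ?V \<Longrightarrow> v \<in> ?V \<Longrightarrow> (\<Sum>i<?n. x i u * x i v) = (if u = v then 1 else 0)"
    and eig: "\<And>i u. i < ?n \<Longrightarrow> u \<in> ?V \<Longrightarrow> (\<Sum>v\<in>?V. f u v * x i v) = es ! i * x i u"
    by (rule symmetric_matrix_along_eigenbasis[where f = f, OF vs(1) sym, folded es_def]) (assumption | rule that)+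
  have mono: "es ! j \<le> es ! i" if "i \<le> j" "j < ?n" for i j
    using eigenvalues_desc_mono[of i j] that len unfolding es_def by simp
  \<comment> \<open>Eigenfunctions of a symmetric matrix for different eigenvalues are orthogonal.
    If \<open>e\<close> were missing from the list, \<open>y\<close> would be orthogonal to the
    whole basis and hence zero.\<close>
  have mem: "\<exists>i<?n. es ! i = e" if y: "eigvec e y" "v \<in> ?V" "y v \<noteq> 0" for e y v
  proof (rule ccontr)
    assume no: "\<not> (\<exists>i<?n. es ! i = e)"
    define a where "a i = (\<Sum>v\<in>?V. y v * x i v)" for i
    have a0: "a i = 0" if i: "i < ?n" for i
    proof -
      have "e * a i = (\<Sum>v\<in>?V. (\<Sum>w\<in>?V. f v w * y w) * x i v)"
        using y(1) unfolding eigvec_def a_def by (simp add: sum_distrib_left mult.assoc)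
      also have "\<dots> = (\<Sum>v\<in>?V. \<Sum>w\<in>?V. y w * (f w v * x i v))"
        unfolding sum_distrib_right using sym by (intro sum.cong) (simp_all add: algebra_simps)
      also have "\<dots> = (\<Sum>w\<in>?V. y w * (es ! i * x i w))"
        by (subst sum.swap) (simp add: sum_distrib_left[symmetric] eig i)
      also have "\<dots> = es ! i * a i"
        by (simp add: a_def sum_distrib_left algebra_simps)
      finally show ?thesis
        using no i by auto
    qed
    have "y v = (\<Sum>u\<in>?V. y u * (\<Sum>i<?n. x i u * x i v))"
      using y(2) by (simp add: compl if_distrib[of "\<lambda>x. _ * x"] cong: if_cong)
    also have "\<dots> = (\<Sum>u\<in>?V. \<Sum>i<?n. y u * x i u * x i v)"
      by (simp add: sum_distrib_left mult.assoc)
    also have "\<dots> = (\<Sum>i<?n. a i * x i v)"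
      by (subst sum.swap) (simp add: sum_distrib_right a_def)
    finally show False
      using y(3) a0 by simp
  qed
  have basis: "eigvec (es ! i) (x i)" if "i < ?n" for i
    unfolding eigvec_def using eig[OF that] by blast
  have nonzero: "\<exists>v\<in>?V. x i v \<noteq> 0" if "i < ?n" for i
  proof (rule ccontr)
    assume "\<not> (\<exists>v\<in>?V. x i v \<noteq> 0)"
    then show False
      using orth[OF that that] by simp
  qed
  obtain j where j: "j < ?n" "es ! j = l"
    using mem[OF y] by blast
  obtain k where k: "k < ?n" "es ! k = c"
    using mem[OF z] by blast
  have "es ! 0 \<ge> l"
    using mono[of 0 j] j by simp
  \<comment> \<open>Position 0 holds a value of at least \<open>l\<close>, so \<open>c\<close>
    stands at position 1 or later.\<close>
  then have "k \<noteq> 0"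
    using k \<open>c < l\<close> by (metis leD)
  then have n: "1 < ?n" and "es ! 1 \<ge> c"
    using k mono[of 1 k] by auto
  then have "0 < ?n"
    by linarith
  have False if gt: "es ! 1 > c"
  proof -
    have "es ! 0 > c"
      using gt mono[of 0 1] n by simp
    have big: "es ! i = l" if "i < ?n" "es ! i > c" for i
      using only basis nonzero that by metis
    have "es ! 0 = l" "es ! 1 = l"
      using gt \<open>es ! 0 > c\<close> n by (auto intro!: big)
    then have e: "eigvec l (x 0)" "eigvec l (x 1)"
      using basis[OF \<open>0 < ?n\<close>] basis[OF n] by simp_all
    \<comment> \<open>If \<open>l\<close> filled the first two positions, this combination of
      \<open>x 0\<close> and \<open>x 1\<close> would be an eigenfunction for \<open>l\<close>
      vanishing at \<open>u\<close>, hence zero. Its product with \<open>x 0\<close> then gives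
      \<open>x 1 u = 0\<close>, which makes \<open>x 1\<close> vanish.\<close>
    define y where "y v = x 1 u * x 0 v - x 0 u * x 1 v" for v
    have "(\<Sum>w\<in>?V. f v w * y w) =
        x 1 u * (\<Sum>w\<in>?V. f v w * x 0 w) - x 0 u * (\<Sum>w\<in>?V. f v w * x 1 w)" for v
      by (simp add: y_def right_diff_distrib sum_subtractf sum_distrib_left mult.left_commute)
    then have "eigvec l y"
      using e unfolding eigvec_def by (simp add: y_def right_diff_distrib mult.left_commute)
    moreover have "y u = 0"
      by (simp add: y_def)
    ultimately have y0: "\<forall>v\<in>?V. y v = 0"
      using simple(2) by blast
    have "x 1 u = (\<Sum>v\<in>?V. y v * x 0 v)"
      using orth[OF \<open>0 < ?n\<close> \<open>0 < ?n\<close>] orth[OF n \<open>0 < ?n\<close>]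
      by (simp add: y_def left_diff_distrib sum_subtractf mult.assoc flip: sum_distrib_left)
    then have "x 1 u = 0"
      using y0 by simp
    then show False
      using simple(2)[OF e(2)] nonzero[of 1] n by blast
  qed
  with \<open>es ! 1 \<ge> c\<close> show ?thesis
    unfolding es_def by fastforce
qed

section \<open>Distances and eccentricities in complements\<close>

lemma graph_dist_eqI:
  assumes "pair_graph G" "pre_digraph.awalk (with_proj G) u p v"
    and "\<And>q. pre_digraph.awalk (with_proj G) u q v \<Longrightarrow> length p \<le> length q"
  shows "graph_dist G u v = real (length p)"
proof -
  interpret pair_graph G by fact
  have "u \<rightarrow>\<^sup>*\<^bsub>with_proj G\<^esub> v"
    using assms(2) reachable_awalk by blast
  moreover have "(LEAST k. \<exists>q. awalk u q v \<and> length q = k) = length p"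
    using assms(2,3) by (intro Least_equality) auto
  ultimately show ?thesis
    using graph_dist_eq_Least[OF assms(1)] by simp
qed

lemma graph_dist_self:
  assumes "pair_graph G" "u \<in> pverts G"
  shows "graph_dist G u u = 0"
proof -
  interpret pair_graph G by fact
  have "awalk u [] u"
    using assms(2) by (simp add: awalk_Nil_iff)
  then show ?thesis
    using graph_dist_eqI[OF assms(1), of u "[]" u] by simp
qed

lemma graph_dist_1:
  assumes "pair_graph G" "(u, v) \<in> parcs G"
  shows "graph_dist G u v = 1"
proof -
  interpret pair_graph G by fact
  have "awalk u [(u, v)] v"
    using assms(2) in_arcsD2 by (auto simp: awalk_simps)
  moreover have "Suc 0 \<le> length q" if "awalk u q v" for q
    using that pair_no_loops[OF assms(2)] by (cases q) (auto simp: awalk_simps)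
  ultimately show ?thesis
    using graph_dist_eqI[OF assms(1), of u "[(u, v)]" v] by simp
qed

lemma graph_dist_2:
  assumes "pair_graph G" "u \<noteq> v" "(u, v) \<notin> parcs G" "(u, w) \<in> parcs G" "(w, v) \<in> parcs G"
  shows "graph_dist G u v = 2"
proof -
  interpret pair_graph G by fact
  have "awalk u [(u, w), (w, v)] v"
    using assms in_arcsD2 by (auto simp: awalk_simps)
  \<comment> \<open>\<open>remdups_adj.cases\<close> serves as the case split into empty,
    one-element and longer lists.\<close>
  moreover have "2 \<le> length q" if "awalk u q v" for q
    using that assms by (cases q rule: remdups_adj.cases) (auto simp: awalk_simps)
  ultimately show ?thesis
    using graph_dist_eqI[OF assms(1), of u "[(u, w), (w, v)]" v]
    by (simp add: numeral_2_eq_2)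
qed

lemma graph_dist_3:
  assumes "pair_graph G" "u \<noteq> v" "(u, v) \<notin> parcs G"
    and "\<And>w. (u, w) \<in> parcs G \<Longrightarrow> (w, v) \<notin> parcs G"
    and "(u, x) \<in> parcs G" "(x, y) \<in> parcs G" "(y, v) \<in> parcs G"
  shows "graph_dist G u v = 3"
proof -
  interpret pair_graph G by fact
  have "awalk u [(u, x), (x, y), (y, v)] v"
    using assms in_arcsD2 by (auto simp: awalk_simps)
  moreover have "3 \<le> length q" if q: "awalk u q v" for q
  proof (rule ccontr)
    assume "\<not> 3 \<le> length q"
    then consider "q = []" | e where "q = [e]" | e e' where "q = [e, e']"
      by (cases q rule: remdups_adj.cases) (auto simp: Suc_le_eq)
    then show False
      using q assms by cases (auto simp: awalk_simps)
  qed
  ultimately show ?thesis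
    using graph_dist_eqI[OF assms(1), of u "[(u, x), (x, y), (y, v)]" v]
    by (simp add: numeral_3_eq_3)
qed

lemma parcs_compl_graph_iff:
  "(u, v) \<in> parcs (compl_graph G) \<longleftrightarrow> u \<in> pverts G \<and> v \<in> pverts G \<and> u \<noteq> v \<and> (u, v) \<notin> parcs G"
  by (simp add: compl_graph_def)

lemma pverts_compl_graph [simp]: "pverts (compl_graph G) = pverts G"
  by (simp add: compl_graph_def)

lemma ecc_eqI:
  assumes "finite (pverts G)" "v \<in> pverts G" "graph_dist G u v = k"
    and "\<And>w. w \<in> pverts G \<Longrightarrow> graph_dist G u w \<le> k"
  shows "ecc G u = k"
  unfolding ecc_def using assms by (intro Max_eqI) auto

lemma pair_graph_arcs:
  assumes "pair_graph G" "(u, v) \<in> parcs G"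
  shows "(v, u) \<in> parcs G" "u \<in> pverts G" "v \<in> pverts G" "u \<noteq> v"
proof -
  interpret pair_graph G by fact
  show "(v, u) \<in> parcs G"
    using assms(2) pair_sym_arcs by (auto simp: symmetric_def sym_def)
  show "u \<in> pverts G" "v \<in> pverts G" "u \<noteq> v"
    using assms(2) in_arcsD1 in_arcsD2 pair_no_loops[OF assms(2)] by auto
qed

text \<open>In a simple graph these are the edges whose ends have no common neighbour in the
  complement, that is, the edges whose ends do not have distance 2 there.\<close>

definition dominating_edge :: "'a pair_pre_digraph \<Rightarrow> 'a \<Rightarrow> 'a \<Rightarrow> bool" where
  "dominating_edge G u v \<longleftrightarrow> (u, v) \<in> parcs G \<and>
     (\<forall>w\<in>pverts G. (u, w) \<in> parcs G \<or> (v, w) \<in> parcs G)"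

text \<open>Ends of an edge have complement distance 2, through a vertex adjacent to neither; other
  distinct vertices have distance 1. Every vertex lies on an edge, so all eccentricities are 2, and
  only the edges of \<open>G\<close> give nonzero entries.\<close>

lemma ecc_entry_compl_graph:
  assumes G: "pair_graph G"
    and no_isolated: "\<And>u. u \<in> pverts G \<Longrightarrow> \<exists>v. (u, v) \<in> parcs G"
    and no_dominating: "\<And>u v. \<not> dominating_edge G u v"
    and uv: "u \<in> pverts G" "v \<in> pverts G"
  shows "ecc_entry (compl_graph G) u v = (if (u, v) \<in> parcs G then 2 else 0)"
proof -
  interpret pair_graph G by fact
  let ?H = "compl_graph G"
  note H = pair_graph_compl_graph[OF G]
  note arcs = pair_graph_arcs[OF G]
  have fin: "finite (pverts ?H)"
    using pair_finite_verts by simp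
  have dist: "graph_dist ?H u v = (if (u, v) \<in> parcs G then 2 else if u = v then 0 else 1)"
    if uv: "u \<in> pverts G" "v \<in> pverts G" for u v
  proof (cases "(u, v) \<in> parcs G")
    case True
    then obtain w where "w \<in> pverts G" "(u, w) \<notin> parcs G" "(v, w) \<notin> parcs G"
      using no_dominating[of u v] by (auto simp: dominating_edge_def)
    with True uv have "(u, w) \<in> parcs ?H" "(w, v) \<in> parcs ?H"
      using arcs by (auto simp: parcs_compl_graph_iff)
    with True show ?thesis
      using graph_dist_2[OF H, of u v w] arcs by (simp add: parcs_compl_graph_iff)
  next
    case False
    then show ?thesis
      using uv graph_dist_self[OF H] graph_dist_1[OF H, of u v]
      by (auto simp: parcs_compl_graph_iff)
  qed
  have "ecc ?H u = 2" if u: "u \<in> pverts G" for u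
  proof -
    obtain v where "(u, v) \<in> parcs G"
      using no_isolated[OF u] by blast
    then show ?thesis
      using dist u arcs fin by (intro ecc_eqI[of _ v]) auto
  qed
  then show ?thesis
    using uv dist by (simp add: ecc_entry_def)
qed

text \<open>\<open>A\<close> and \<open>B\<close> are the leaf sets at the centres \<open>u\<close>
  and \<open>v\<close>. Requiring both to be nonempty excludes stars.\<close>

definition double_star :: "'a pair_pre_digraph \<Rightarrow> 'a \<Rightarrow> 'a \<Rightarrow> 'a set \<Rightarrow> 'a set \<Rightarrow> bool" where
  "double_star G u v A B \<longleftrightarrow> finite A \<and> finite B \<and> A \<noteq> {} \<and> B \<noteq> {} \<and> A \<inter> B = {} \<and>
     u \<noteq> v \<and> u \<notin> A \<union> B \<and> v \<notin> A \<union> B \<and> pverts G = {u, v} \<union> A \<union> B \<and>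
     parcs G = (let E = {(u, v)} \<union> {u} \<times> A \<union> {v} \<times> B in E \<union> E\<inverse>)"

lemma double_star_arcs_iff:
  assumes "double_star G u v A B"
  shows "(x, y) \<in> parcs G \<longleftrightarrow> (x, y) \<in> {(u, v), (v, u)} \<or> x = u \<and> y \<in> A \<or> x \<in> A \<and> y = u
    \<or> x = v \<and> y \<in> B \<or> x \<in> B \<and> y = v"
  using assms by (auto simp: double_star_def Let_def)

lemma double_star_swap:
  assumes "double_star G u v A B"
  shows "double_star G v u B A"
proof -
  have "(let E = {(u, v)} \<union> {u} \<times> A \<union> {v} \<times> B in E \<union> E\<inverse>) =
      (let E = {(v, u)} \<union> {v} \<times> B \<union> {u} \<times> A in E \<union> E\<inverse>)"
    unfolding Let_def by auto
  moreover have "{u, v} \<union> A \<union> B = {v, u} \<union> B \<union> A"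
    by auto
  ultimately show ?thesis
    using assms unfolding double_star_def by (simp add: Int_commute eq_commute[of v u])
qed

lemma double_star_pair_graph:
  assumes ds: "double_star G u v A B"
  shows "pair_graph G"
proof -
  note iff = double_star_arcs_iff[OF ds]
  have V: "pverts G = {u, v} \<union> A \<union> B" and fin: "finite (pverts G)"
    using ds by (auto simp: double_star_def)
  have "parcs G \<subseteq> pverts G \<times> pverts G"
    unfolding V by (auto simp: iff)
  moreover from this have "finite (parcs G)"
    by (rule finite_subset) (use fin in simp)
  moreover have "sym (parcs G)"
    by (rule symI) (simp only: iff, blast)
  moreover have "(x, x) \<notin> parcs G" for x
    using ds iff[of x x] by (auto simp: double_star_def)
  ultimately show ?thesis
    using fin by unfold_locales (auto simp: symmetric_def dest: subsetD)
qed

lemma card_double_star: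
  assumes "double_star G u v A B"
  shows "card (pverts G) = card A + card B + 2"
proof -
  have "pverts G = insert u (insert v (A \<union> B))"
    using assms by (auto simp: double_star_def)
  then show ?thesis
    using assms by (simp add: double_star_def card_Un_disjoint)
qed

text \<open>In the complement all leaves are mutually adjacent and each is adjacent to the centre
  opposite its own. So the centres have distance and eccentricity 3, while a leaf has eccentricity
  2, attained at its own centre.\<close>

lemma ecc_entry_compl_double_star:
  assumes ds: "double_star G u v A B" and xy: "x \<in> pverts G" "y \<in> pverts G"
  shows "ecc_entry (compl_graph G) x y =
    (if (x, y) \<in> {(u, v), (v, u)} then 3 else if (x, y) \<in> parcs G then 2 else 0)"
proof -
  let ?H = "compl_graph G"
  note G = double_star_pair_graph[OF ds]
  note H = pair_graph_compl_graph[OF G]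
  note arcs_iff = double_star_arcs_iff[OF ds]
  have V: "pverts G = {u, v} \<union> A \<union> B" and fin: "finite (pverts ?H)"
    and dis: "A \<inter> B = {}" "u \<noteq> v" "u \<notin> A" "u \<notin> B" "v \<notin> A" "v \<notin> B"
    using ds by (auto simp: double_star_def)
  obtain a b where ab: "a \<in> A" "b \<in> B"
    using ds by (auto simp: double_star_def)
  have far: "graph_dist ?H x y = 3" if "(x, y) \<in> {(u, v), (v, u)}" for x y
  proof -
    \<comment> \<open>The shortest walk is \<open>u, b, a, v\<close>; a common neighbour of the
      centres in the complement does not exist.\<close>
    have "graph_dist ?H u v = 3"
      using ab dis V by (intro graph_dist_3[OF H, of _ _ b a]) (auto simp: parcs_compl_graph_iff arcs_iff)
    moreover have "graph_dist ?H v u = 3"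
      using ab dis V by (intro graph_dist_3[OF H, of _ _ a b]) (auto simp: parcs_compl_graph_iff arcs_iff)
    ultimately show ?thesis
      using that by auto
  qed
  \<comment> \<open>A leaf reaches its own centre through any leaf of the other centre.\<close>
  have mid: "graph_dist ?H x y = 2" if "(x, y) \<in> parcs G" "(x, y) \<notin> {(u, v), (v, u)}" for x y
  proof -
    from that consider "x = u" "y \<in> A" | "x \<in> A" "y = u" | "x = v" "y \<in> B" | "x \<in> B" "y = v"
      by (auto simp: arcs_iff)
    then show ?thesis
    proof cases
      case 1
      then show ?thesis
        using ab dis V by (intro graph_dist_2[OF H, of _ _ b]) (auto simp: parcs_compl_graph_iff arcs_iff)
    next
      case 2
      then show ?thesis
        using ab dis V by (intro graph_dist_2[OF H, of _ _ b]) (auto simp: parcs_compl_graph_iff arcs_iff)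
    next
      case 3
      then show ?thesis
        using ab dis V by (intro graph_dist_2[OF H, of _ _ a]) (auto simp: parcs_compl_graph_iff arcs_iff)
    next
      case 4
      then show ?thesis
        using ab dis V by (intro graph_dist_2[OF H, of _ _ a]) (auto simp: parcs_compl_graph_iff arcs_iff)
    qed
  qed
  have dist: "graph_dist ?H x y = (if (x, y) \<in> {(u, v), (v, u)} then 3
      else if (x, y) \<in> parcs G then 2 else if x = y then 0 else 1)"
    if xy: "x \<in> pverts G" "y \<in> pverts G" for x y
    using far[of x y] mid[of x y] graph_dist_self[OF H, of x] graph_dist_1[OF H, of x y] xy
    by (auto simp: parcs_compl_graph_iff)
  have ecc_u: "ecc ?H u = 3"
    using V fin dis by (intro ecc_eqI[of _ v]) (auto simp: dist)
  have ecc_v: "ecc ?H v = 3"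
    using V fin dis by (intro ecc_eqI[of _ u]) (auto simp: dist)
  have ecc_A: "ecc ?H x = 2" if "x \<in> A" for x
    using V fin dis that by (intro ecc_eqI[of _ u]) (auto simp: dist arcs_iff)
  have ecc_B: "ecc ?H x = 2" if "x \<in> B" for x
    using V fin dis that by (intro ecc_eqI[of _ v]) (auto simp: dist arcs_iff)
  have ecc: "ecc ?H x = (if x \<in> {u, v} then 3 else 2)" if "x \<in> pverts G" for x
    using that ecc_u ecc_v ecc_A ecc_B V by auto
  consider "(x, y) \<in> {(u, v), (v, u)}" | "(x, y) \<notin> {(u, v), (v, u)}" "(x, y) \<in> parcs G" |
    "(x, y) \<notin> {(u, v), (v, u)}" "(x, y) \<notin> parcs G"
    by blast
  then show ?thesis
  proof cases
    case 1
    then show ?thesis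
      unfolding ecc_entry_def dist[OF xy] ecc[OF xy(1)] ecc[OF xy(2)] by auto
  next
    case 2
    then have "\<not> (x \<in> {u, v} \<and> y \<in> {u, v})"
      using dis by (auto simp: arcs_iff)
    with 2 show ?thesis
      unfolding ecc_entry_def dist[OF xy] ecc[OF xy(1)] ecc[OF xy(2)] by auto
  next
    case 3
    then show ?thesis
      unfolding ecc_entry_def dist[OF xy] ecc[OF xy(1)] ecc[OF xy(2)] by auto
  qed
qed

section \<open>Double stars up to isomorphism\<close>

lemma map_prod_double_star_arcs:
  "map_prod f f ` (let E = {(u, v)} \<union> {u} \<times> A \<union> {v} \<times> B in E \<union> E\<inverse>) =
   (let E = {(f u, f v)} \<union> {f u} \<times> f ` A \<union> {f v} \<times> f ` B in E \<union> E\<inverse>)"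
proof -
  have times: "map_prod f f ` (X \<times> Y) = f ` X \<times> f ` Y" for X Y
    by force
  have converse: "map_prod f f ` (E\<inverse>) = (map_prod f f ` E)\<inverse>" for E
    by force
  show ?thesis
    by (simp add: Let_def image_Un times converse)
qed

text \<open>The value of \<open>xi2\<close> on the complement of a double star will depend only on
  the two leaf counts. Carrying these along an isomorphism replaces a proof that \<open>xi2\<close>
  is an isomorphism invariant in general.\<close>

lemma digraph_iso_double_star_image:
  assumes ds: "double_star G u v A B" and iso: "digraph_iso (with_proj G) (with_proj H)"
  obtains u' v' A' B' where "double_star H u' v' A' B'" "card A' = card A" "card B' = card B"
proof -
  obtain f where f: "inj_on f (pverts G)" "pverts H = f ` pverts G" "parcs H = map_prod f f ` parcs G"
    using iso unfolding digraph_iso_iff[OF double_star_pair_graph[OF ds]] by (elim exE conjE)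
  have V: "pverts G = {u, v} \<union> A \<union> B"
    and dis: "A \<inter> B = {}" "u \<noteq> v" "u \<notin> A \<union> B" "v \<notin> A \<union> B"
    using ds by (simp_all add: double_star_def)
  have "double_star H (f u) (f v) (f ` A) (f ` B)"
    unfolding double_star_def
  proof (intro conjI)
    show "f ` A \<inter> f ` B = {}"
      using inj_on_image_Int[OF f(1), of A B] dis unfolding V by auto
    show "f u \<noteq> f v"
      using inj_on_eq_iff[OF f(1), of u v] dis unfolding V by simp
    show "f u \<notin> f ` A \<union> f ` B" "f v \<notin> f ` A \<union> f ` B"
      using inj_on_image_mem_iff[OF f(1), of u "A \<union> B"] inj_on_image_mem_iff[OF f(1), of v "A \<union> B"]
        dis unfolding V by auto
    show "parcs H = (let E = {(f u, f v)} \<union> {f u} \<times> f ` A \<union> {f v} \<times> f ` B in E \<union> E\<inverse>)"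
      using ds unfolding f(3) double_star_def map_prod_double_star_arcs[symmetric] by simp
    show "pverts H = {f u, f v} \<union> f ` A \<union> f ` B"
      unfolding f(2) V by (simp add: image_Un)
  qed (use ds in \<open>simp_all add: double_star_def\<close>)
  moreover have "card (f ` A) = card A" "card (f ` B) = card B"
    by (intro card_image inj_on_subset[OF f(1)], simp add: V le_supI1 le_supI2 subset_insertI2)+
  ultimately show thesis
    by (rule that)
qed

text \<open>The leaf counts determine the graph: match the centres and glue bijections between the
  leaf sets.\<close>

lemma double_star_digraph_iso:
  assumes G: "double_star G u v A B" and H: "double_star H u' v' A' B'"
    and card: "card A = card A'" "card B = card B'"
  shows "digraph_iso (with_proj G) (with_proj H)"
proof -
  obtain h k where h: "bij_betw h A A'" and k: "bij_betw k B B'"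
    using G H card finite_same_card_bij unfolding double_star_def by metis
  define f where "f x = (if x = u then u' else if x = v then v' else if x \<in> A then h x else k x)" for x
  have fu: "f u = u'" "f v = v'"
    using G by (auto simp: f_def double_star_def)
  have fA: "f x = h x" if "x \<in> A" for x
    using G that by (auto simp: f_def double_star_def)
  have fB: "f x = k x" if "x \<in> B" for x
    using G that by (auto simp: f_def double_star_def)
  have img: "f ` A = A'" "f ` B = B'"
    using h k fA fB by (auto simp: bij_betw_def)
  have "inj_on f A" "inj_on f B"
    using h k fA fB by (auto simp: bij_betw_def inj_on_def)
  moreover have V: "pverts G = {u, v} \<union> A \<union> B"
    using G by (simp add: double_star_def)
  ultimately have "inj_on f (pverts G)"
    using G H img fu unfolding double_star_def V by (auto simp: inj_on_Un)
  moreover have "pverts H = f ` pverts G"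
    using G H img fu by (auto simp: double_star_def image_Un)
  moreover have "parcs H = map_prod f f ` parcs G"
  proof -
    have "parcs H = (let E = {(f u, f v)} \<union> {f u} \<times> f ` A \<union> {f v} \<times> f ` B in E \<union> E\<inverse>)"
      using H unfolding img fu double_star_def by simp
    then show ?thesis
      using G unfolding double_star_def map_prod_double_star_arcs[symmetric] by simp
  qed
  ultimately show ?thesis
    using digraph_iso_iff[OF double_star_pair_graph[OF G]] by blast
qed

text \<open>The path end 3 counts as one of the leaves at vertex 2, which gives 1 and
  \<open>n - 3\<close> leaves.\<close>

lemma double_star_tree_n3:
  assumes "n \<ge> 4"
  shows "double_star (tree_n3 n) 1 2 {0} {3..<n}"
proof -
  have "{3..<n} = insert 3 {k. 4 \<le> k \<and> k < n}"
    using assms by auto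
  then have "parcs (tree_n3 n) = (let E = {(1, 2)} \<union> {1} \<times> {0} \<union> {2} \<times> {3..<n} in E \<union> E\<inverse>)"
    unfolding tree_n3_def Let_def by auto
  moreover have "pverts (tree_n3 n) = {1, 2} \<union> {0} \<union> {3..<n}"
    using assms by (auto simp: tree_n3_def Let_def)
  ultimately show ?thesis
    using assms by (simp add: double_star_def)
qed

section \<open>Trees and dominating edges\<close>

lemma is_tree_pair_graph: "is_tree G \<Longrightarrow> pair_graph G"
  unfolding is_tree_def by (elim conjE)

lemma is_tree_connected: "is_tree G \<Longrightarrow> Digraph_Component.connected (with_proj G)"
  unfolding is_tree_def by (elim conjE)

text \<open>Lengths 3, 4 and 5 suffice because the arguments below close up paths on at most five
  vertices. In a triangle the vertices are distinct by looplessness; for the longer cycles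
  distinctness is assumed.\<close>

lemma is_tree_no_cycle:
  assumes T: "is_tree G"
  shows "(a, b) \<in> parcs G \<Longrightarrow> (b, c) \<in> parcs G \<Longrightarrow> (c, a) \<notin> parcs G"
    and "(a, b) \<in> parcs G \<Longrightarrow> (b, c) \<in> parcs G \<Longrightarrow> (c, d) \<in> parcs G \<Longrightarrow> distinct [a, b, c, d] \<Longrightarrow>
      (d, a) \<notin> parcs G"
    and "(a, b) \<in> parcs G \<Longrightarrow> (b, c) \<in> parcs G \<Longrightarrow> (c, d) \<in> parcs G \<Longrightarrow> (d, e) \<in> parcs G \<Longrightarrow>
      distinct [a, b, c, d, e] \<Longrightarrow> (e, a) \<notin> parcs G"
proof -
  interpret pair_graph G
    using T by (rule is_tree_pair_graph)
  note arcs = pair_graph_arcs[OF is_tree_pair_graph[OF T]]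
  have no_cycles: "\<not> (\<exists>p. cycle p \<and> 3 \<le> length p)"
    using T unfolding is_tree_def by (elim conjE)
  have no: "\<not> cycle p" if "3 \<le> length p" for p
    using no_cycles that by (metis (no_types))
  note d = cycle_def awalk_simps
  show "(c, a) \<notin> parcs G" if "(a, b) \<in> parcs G" "(b, c) \<in> parcs G"
  proof
    note ends = arcs(2,4)[OF that(1)] arcs(4)[OF that(2)]
    assume "(c, a) \<in> parcs G"
    with arcs(4)[OF this] have "cycle [(a, b), (b, c), (c, a)]"
      unfolding d using that ends by (intro exI[of _ a]) auto
    with no show False
      by fastforce
  qed
  show "(d, a) \<notin> parcs G"
    if "(a, b) \<in> parcs G" "(b, c) \<in> parcs G" "(c, d) \<in> parcs G" "distinct [a, b, c, d]"
  proof
    note ends = arcs(2,4)[OF that(1)]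
    assume "(d, a) \<in> parcs G"
    then have "cycle [(a, b), (b, c), (c, d), (d, a)]"
      unfolding d using that ends by (intro exI[of _ a]) auto
    with no show False
      by fastforce
  qed
  show "(e, a) \<notin> parcs G"
    if "(a, b) \<in> parcs G" "(b, c) \<in> parcs G" "(c, d) \<in> parcs G" "(d, e) \<in> parcs G"
      "distinct [a, b, c, d, e]"
  proof
    note ends = arcs(2,4)[OF that(1)]
    assume "(e, a) \<in> parcs G"
    then have "cycle [(a, b), (b, c), (c, d), (d, e), (e, a)]"
      unfolding d using that ends by (intro exI[of _ a]) auto
    with no show False
      by fastforce
  qed
qed

text \<open>By connectedness a walk leads from \<open>s\<close> inside \<open>S\<close> to
  \<open>w\<close> outside; if no arc left \<open>S\<close>, everything reachable from
  \<open>s\<close> would stay in \<open>S\<close>.\<close>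

lemma is_tree_boundary_arc:
  assumes T: "is_tree G" and "s \<in> S" "s \<in> pverts G" "w \<in> pverts G" "w \<notin> S"
  obtains x y where "x \<in> S" "y \<notin> S" "(x, y) \<in> parcs G"
proof -
  interpret pair_graph G
    using T by (rule is_tree_pair_graph)
  have "s \<rightarrow>\<^sup>*\<^bsub>with_proj G\<^esub> w"
    using symmetric_connected_imp_strongly_connected[OF pair_sym_arcs is_tree_connected[OF T]] assms(3,4)
    by (simp add: strongly_connected_def)
  moreover have "x \<in> S" if "s \<rightarrow>\<^sup>*\<^bsub>with_proj G\<^esub> x" "\<nexists>x y. x \<in> S \<and> y \<notin> S \<and> (x, y) \<in> parcs G" for x
    using that(1)
  proof (induction rule: reachable_induct)
    case base
    then show ?case using assms by simp
  next
    case (step x y)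
    then show ?case using that(2) by auto
  qed
  ultimately show thesis
    using that assms by metis
qed

lemma is_tree_no_isolated:
  assumes "is_tree G" "card (pverts G) \<ge> 2" "u \<in> pverts G"
  shows "\<exists>v. (u, v) \<in> parcs G"
proof -
  have "\<not> pverts G \<subseteq> {u}"
    using assms(2) card_mono[of "{u}" "pverts G"] by auto
  then obtain w where "w \<in> pverts G" "w \<noteq> u"
    by blast
  then obtain x y where "x \<in> {u}" "(x, y) \<in> parcs G"
    using is_tree_boundary_arc[OF assms(1), of u "{u}" w] assms(3) by blast
  then show ?thesis
    by blast
qed

text \<open>Domination places every vertex in \<open>{u, v}\<close> or in one of the two neighbour
  sets. A common neighbour, or an edge within one of these sets, would close a triangle, and an edge
  between them a 4-cycle.\<close>

lemma is_tree_dominating_edge_double_star: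
  assumes T: "is_tree G" and dom: "dominating_edge G u v"
    and A: "\<exists>w. w \<noteq> v \<and> (u, w) \<in> parcs G" and B: "\<exists>w. w \<noteq> u \<and> (v, w) \<in> parcs G"
  shows "double_star G u v {w. w \<noteq> v \<and> (u, w) \<in> parcs G} {w. w \<noteq> u \<and> (v, w) \<in> parcs G}"
    (is "double_star G u v ?A ?B")
proof -
  interpret pair_graph G
    using T by (rule is_tree_pair_graph)
  note arcs = pair_graph_arcs[OF is_tree_pair_graph[OF T]]
  note no3 = is_tree_no_cycle(1)[OF T] and no4 = is_tree_no_cycle(2)[OF T]
  have uv: "(u, v) \<in> parcs G" "(v, u) \<in> parcs G"
    using dom arcs(1) unfolding dominating_edge_def by blast+
  have cover: "w \<in> {u, v} \<union> ?A \<union> ?B" if "w \<in> pverts G" for w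
    using dom that unfolding dominating_edge_def by blast
  have AA: "(x, y) \<notin> parcs G" if "x \<in> ?A" "y \<in> ?A" for x y
    using no3[of u x y] that arcs(1) by blast
  have BB: "(x, y) \<notin> parcs G" if "x \<in> ?B" "y \<in> ?B" for x y
    using no3[of v x y] that arcs(1) by blast
  have disj: "?A \<inter> ?B = {}"
    using no3[of u v] arcs(1) uv by blast
  have AB: "(x, y) \<notin> parcs G" if "x \<in> ?A" "y \<in> ?B" for x y
  proof -
    have "(x, u) \<in> parcs G" "(v, y) \<in> parcs G" "distinct [x, u, v, y]"
      using that disj uv arcs(1) arcs(4)[of u x] arcs(4)[of v y] arcs(4)[OF uv(1)] by auto
    then show ?thesis
      using no4[of x u v y] uv arcs(1) by blast
  qed
  have fin: "finite ?A" "finite ?B"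
    using pair_finite_verts arcs(3) by (auto intro: finite_subset[of _ "pverts G"])
  let ?R = "let E = {(u, v)} \<union> {u} \<times> ?A \<union> {v} \<times> ?B in E \<union> E\<inverse>"
  have arcs_iff: "(x, y) \<in> parcs G \<longleftrightarrow> (x, y) \<in> ?R" for x y
  proof
    assume xy: "(x, y) \<in> parcs G"
    then show "(x, y) \<in> ?R"
      using cover[of x] cover[of y] AA[of x y] BB[of x y] AB[of x y] AB[of y x] arcs[OF xy]
      unfolding Let_def by auto
  next
    assume "(x, y) \<in> ?R"
    then show "(x, y) \<in> parcs G"
      using uv arcs(1) unfolding Let_def by blast
  qed
  have "parcs G = ?R"
  proof (rule Set.set_eqI)
    fix z show "z \<in> parcs G \<longleftrightarrow> z \<in> ?R"
      using arcs_iff[of "fst z" "snd z"] by (simp only: prod.collapse)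
  qed
  moreover have "pverts G = {u, v} \<union> ?A \<union> ?B"
  proof
    show "pverts G \<subseteq> {u, v} \<union> ?A \<union> ?B"
      using cover by (rule subsetI)
    show "{u, v} \<union> ?A \<union> ?B \<subseteq> pverts G"
      using arcs(2)[OF uv(1)] arcs(3)[OF uv(1)] arcs(3) by blast
  qed
  moreover have "?A \<noteq> {}" "?B \<noteq> {}"
    using A B by blast+
  moreover have "u \<notin> ?A \<union> ?B" "v \<notin> ?A \<union> ?B"
    using arcs(4)[of u u] arcs(4)[of v v] by blast+
  ultimately show ?thesis
    using fin disj arcs(4)[OF uv(1)] unfolding double_star_def by (intro conjI)
qed

text \<open>If \<open>v\<close> is the only neighbour of \<open>u\<close>, domination makes
  \<open>v\<close> adjacent to all other vertices, and any further edge would close a triangle. This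
  is the case that the main theorem excludes.\<close>

lemma is_tree_dominating_leaf_star:
  assumes T: "is_tree G" and dom: "dominating_edge G u v"
    and leaf: "\<And>w. (u, w) \<in> parcs G \<Longrightarrow> w = v"
  shows "complete_bipartite_digraph 1 (card (pverts G) - 1) (with_proj G)"
proof -
  interpret pair_graph G
    using T by (rule is_tree_pair_graph)
  note arcs = pair_graph_arcs[OF is_tree_pair_graph[OF T]]
  note no3 = is_tree_no_cycle(1)[OF T]
  have uv: "(u, v) \<in> parcs G" "(v, u) \<in> parcs G"
    using dom arcs(1) unfolding dominating_edge_def by blast+
  have nb: "(v, w) \<in> parcs G" if "w \<in> pverts G" "w \<noteq> v" for w
    using dom that leaf unfolding dominating_edge_def by blast
  have "(x, y) \<in> parcs G \<longleftrightarrow> (x, y) \<in> {v} \<times> (pverts G - {v}) \<union> (pverts G - {v}) \<times> {v}" for x y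
    using nb[of x] nb[of y] arcs[of x y] arcs(1)[of v x] arcs(1)[of v y] arcs(4)[of v v] no3[of v x y]
    by blast
  then have "parcs G = {v} \<times> (pverts G - {v}) \<union> (pverts G - {v}) \<times> {v}"
    by auto
  moreover have "v \<in> pverts G"
    using arcs uv by blast
  ultimately have star: "pverts G = {v} \<union> (pverts G - {v}) \<and> {v} \<inter> (pverts G - {v}) = {} \<and>
      card {v} = 1 \<and> card (pverts G - {v}) = card (pverts G) - 1 \<and>
      parcs G = {v} \<times> (pverts G - {v}) \<union> (pverts G - {v}) \<times> {v}"
    using pair_finite_verts by (simp add: insert_absorb)
  show ?thesis
    unfolding complete_bipartite_digraph_pair_def
    by (rule conjI[OF pair_finite_verts], rule exI[of _ "{v}"], rule exI[of _ "pverts G - {v}"], rule star)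
qed

text \<open>
  An edge with further neighbours at both ends extends, if it is not dominating, to a path on five
  vertices; the two end edges of that path are the required pair.
\<close>

lemma is_tree_no_dominating_edge_induced_2K2:
  assumes T: "is_tree G" and card: "card (pverts G) \<ge> 2"
    and no_dom: "\<And>u v. \<not> dominating_edge G u v"
  obtains a b d e where "(a, b) \<in> parcs G" "(d, e) \<in> parcs G" "distinct [a, b, d, e]"
    "({a, b} \<times> {d, e}) \<inter> parcs G = {}"
proof -
  note arcs = pair_graph_arcs[OF is_tree_pair_graph[OF T]]
  note no3 = is_tree_no_cycle(1)[OF T] and no4 = is_tree_no_cycle(2)[OF T]
    and no5 = is_tree_no_cycle(3)[OF T]
  \<comment> \<open>Leave the neighbourhood \<open>?S\<close> of the edge by an arc from
    \<open>z\<close> to \<open>y\<close>. Since \<open>y\<close> is adjacent to neither end,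
    \<open>z\<close> is neither \<open>u\<close> nor \<open>v\<close>.\<close>
  have step: "\<exists>z y. ((u, z) \<in> parcs G \<or> (v, z) \<in> parcs G) \<and> z \<noteq> u \<and> z \<noteq> v \<and> (z, y) \<in> parcs G \<and>
      (u, y) \<notin> parcs G \<and> (v, y) \<notin> parcs G \<and> y \<noteq> u \<and> y \<noteq> v" if uv: "(u, v) \<in> parcs G" for u v
  proof -
    let ?S = "{w. (u, w) \<in> parcs G \<or> (v, w) \<in> parcs G}"
    obtain w where "w \<in> pverts G" "w \<notin> ?S"
      using no_dom[of u v] uv unfolding dominating_edge_def by blast
    moreover have "u \<in> ?S" "u \<in> pverts G"
      using uv arcs by blast+
    ultimately obtain z y where "z \<in> ?S" "y \<notin> ?S" "(z, y) \<in> parcs G"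
      using is_tree_boundary_arc[OF T, of u ?S w] by blast
    then show ?thesis
      using uv arcs(1) by blast
  qed
  \<comment> \<open>On the path \<open>v, u, x, z, y\<close> the arc \<open>u z\<close> would close
    a triangle, \<open>v z\<close> a 4-cycle and \<open>v y\<close> a 5-cycle; \<open>u y\<close> is
    excluded by assumption.\<close>
  have path5: "({v, u} \<times> {z, y}) \<inter> parcs G = {} \<and> distinct [v, u, z, y]"
    if "(v, u) \<in> parcs G" "(u, x) \<in> parcs G" "(x, z) \<in> parcs G" "(z, y) \<in> parcs G"
      "v \<noteq> x" "z \<noteq> u" "y \<noteq> x" "(u, y) \<notin> parcs G" "y \<noteq> u" for v u x z y
  proof -
    note ne = arcs(4)[OF that(1)] arcs(4)[OF that(2)] arcs(4)[OF that(3)] arcs(4)[OF that(4)]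
    have uz: "(u, z) \<notin> parcs G"
      using no3[of u x z] that arcs(1) by blast
    then have vz: "v \<noteq> z"
      using that arcs(1) by blast
    then have "distinct [v, u, x, z]"
      using that ne by auto
    then have nvz: "(v, z) \<notin> parcs G"
      using no4[of v u x z] that arcs(1) by blast
    then have yv: "y \<noteq> v"
      using that arcs(1) by blast
    then have "distinct [v, u, x, z, y]"
      using that ne vz by auto
    then have "(v, y) \<notin> parcs G"
      using no5[of v u x z y] that arcs(1) by blast
    then show ?thesis
      using that uz vz nvz yv ne by auto
  qed
  obtain s where "s \<in> pverts G"
    using card by (cases "pverts G = {}") auto
  then obtain t where st: "(s, t) \<in> parcs G"
    using is_tree_no_isolated[OF T card] by blast
  \<comment> \<open>A first use of \<open>step\<close> extends the edge \<open>s t\<close> to a path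
    on four vertices, whose middle edge has further neighbours at both ends.\<close>
  obtain p u x q where P4: "(p, u) \<in> parcs G" "(u, x) \<in> parcs G" "(x, q) \<in> parcs G" "p \<noteq> x" "q \<noteq> u"
    using step[OF st] arcs(1) st by metis
  \<comment> \<open>A second use, for the middle edge, attaches \<open>z, y\<close> at
    \<open>x\<close> or at \<open>u\<close>; together with \<open>p\<close> or \<open>q\<close>
    respectively this gives the path on five vertices.\<close>
  obtain z y where zy: "(u, z) \<in> parcs G \<or> (x, z) \<in> parcs G" "z \<noteq> u" "z \<noteq> x" "(z, y) \<in> parcs G"
    "(u, y) \<notin> parcs G" "(x, y) \<notin> parcs G" "y \<noteq> u" "y \<noteq> x"
    using step[OF P4(2)] by blast
  from zy(1) show thesis
  proof
    assume "(x, z) \<in> parcs G"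
    from path5[OF P4(1,2) this zy(4) P4(4) zy(2,8,5,7)] show thesis
      by (elim conjE) (rule that[OF P4(1) zy(4)])
  next
    assume "(u, z) \<in> parcs G"
    from path5[OF arcs(1)[OF P4(3)] arcs(1)[OF P4(2)] this zy(4) P4(5) zy(3,7,6,8)] show thesis
      by (elim conjE) (rule that[OF arcs(1)[OF P4(3)] zy(4)])
  qed
qed

section \<open>The second largest eigenvalue\<close>

text \<open>
  With \<open>m = a b\<close>, this is the square root of the smaller root of \<open>X\<^sup>2 - (4 n + 1) X + 16 m\<close>, the
  equation satisfied by the squared nonzero eigenvalues of a double star with \<open>a\<close> and \<open>b\<close> leaves.
\<close>

definition double_star_xi2 :: "nat \<Rightarrow> nat \<Rightarrow> real" where
  "double_star_xi2 n m = sqrt ((4 * real n + 1 - sqrt ((4 * real n + 1)\<^sup>2 - 64 * real m)) / 2)"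

section \<open>Estimates for the closed formula\<close>

lemma double_star_xi2_strict_mono:
  assumes "m < m'" "64 * real m' \<le> (4 * real n + 1)\<^sup>2"
  shows "double_star_xi2 n m < double_star_xi2 n m'"
  using assms unfolding double_star_xi2_def by simp

lemma double_star_xi2_less_2:
  assumes "n \<ge> 4"
  shows "double_star_xi2 n (n - 3) < 2"
proof -
  \<comment> \<open>As \<open>4 n - 7\<close> is \<open>(4 n + 1) - 8\<close>, this says that the
    smaller root is below 4. The two squares compared differ by 144.\<close>
  have "4 * real n - 7 < sqrt ((4 * real n + 1)\<^sup>2 - 64 * real (n - 3))"
    using assms by (intro real_less_rsqrt) (simp add: power2_eq_square algebra_simps of_nat_diff)
  then have "double_star_xi2 n (n - 3) < sqrt 4"
    unfolding double_star_xi2_def by (intro real_sqrt_less_mono) simp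
  then show ?thesis
    by simp
qed

text \<open>Inequality of arithmetic and geometric means; it makes the discriminant
  positive.\<close>

lemma card_prod_bound:
  assumes "n = a + b + 2"
  shows "64 * real (a * b) < (4 * real n + 1)\<^sup>2"
proof -
  have "4 * (real a * real b) \<le> (real a + real b)\<^sup>2"
    using zero_le_power2[of "real a - real b"] by (simp add: power2_eq_square algebra_simps)
  then have "64 * (real a * real b) \<le> (4 * (real a + real b))\<^sup>2"
    by (simp add: power2_eq_square algebra_simps)
  also have "\<dots> < (4 * real n + 1)\<^sup>2"
    unfolding assms by (intro power_strict_mono) auto
  finally show ?thesis
    by simp
qed

text \<open>With \<open>n - 3 = a + b - 1\<close>, the difference \<open>a b - (n - 3)\<close> is
  \<open>(a - 1) (b - 1)\<close>.\<close>

lemma prod_ge_of_sum: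
  fixes a b :: nat
  assumes "n = a + b + 2" "a \<ge> 1" "b \<ge> 1"
  shows "n - 3 \<le> a * b" "a * b = n - 3 \<longleftrightarrow> a = 1 \<or> b = 1"
proof -
  obtain c d where "a = Suc c" "b = Suc d"
    using assms(2,3) by (metis Suc_le_D One_nat_def)
  then have "a * b = (n - 3) + c * d" "a = 1 \<or> b = 1 \<longleftrightarrow> c * d = 0"
    using assms(1) by auto
  then show "n - 3 \<le> a * b" "a * b = n - 3 \<longleftrightarrow> a = 1 \<or> b = 1"
    by auto
qed

text \<open>For \<open>X = e^2\<close> the equation reads
  \<open>X^2 - (4 n + 1) X + 16 a b = 0\<close>, since \<open>4 a + 4 b + 9 = 4 n + 1\<close>. It
  has two distinct positive roots, with square roots \<open>c < l\<close>.\<close>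

lemma double_star_eigenvalue_equation:
  fixes a b n :: nat
  assumes n: "n = a + b + 2" and ab: "a \<ge> 1" "b \<ge> 1"
  defines "c \<equiv> double_star_xi2 n (a * b)"
  obtains l where "0 < c" "c < l"
    "\<And>e :: real. 0 < e \<Longrightarrow> (e\<^sup>2 - 4 * a) * (e\<^sup>2 - 4 * b) = 9 * e\<^sup>2 \<longleftrightarrow> e = c \<or> e = l"
proof -
  define s where "s = 4 * real n + 1"
  define r where "r = sqrt (s\<^sup>2 - 64 * real (a * b))"
  define l where "l = sqrt ((s + r) / 2)"
  have disc: "s\<^sup>2 - 64 * real (a * b) > 0"
    using card_prod_bound[OF n] by (simp add: s_def)
  then have r: "r > 0" "r\<^sup>2 = s\<^sup>2 - 64 * real (a * b)"
    by (auto simp: r_def)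
  have c: "c = sqrt ((s - r) / 2)"
    by (simp add: c_def double_star_xi2_def s_def r_def)
  have s: "s > 0"
    by (simp add: s_def)
  have "r\<^sup>2 < s\<^sup>2"
    using r(2) ab by simp
  then have rs: "r < s"
    using s by (intro power_less_imp_less_base[of r 2 s]) auto
  have c2: "c\<^sup>2 = (s - r) / 2" and l2: "l\<^sup>2 = (s + r) / 2"
    using rs r s by (auto simp: c l_def)
  have "c > 0" "c < l"
    using rs r by (auto simp: c l_def)
  moreover have "(e\<^sup>2 - 4 * a) * (e\<^sup>2 - 4 * b) = 9 * e\<^sup>2 \<longleftrightarrow> e = c \<or> e = l" if "e > 0" for e :: real
  proof -
    have "(e\<^sup>2 - c\<^sup>2) * (e\<^sup>2 - l\<^sup>2) = (e\<^sup>2)\<^sup>2 - s * e\<^sup>2 + (s\<^sup>2 - r\<^sup>2) / 4"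
      unfolding c2 l2 by (simp add: field_simps power2_eq_square)
    also have "\<dots> = (e\<^sup>2 - 4 * a) * (e\<^sup>2 - 4 * b) - 9 * e\<^sup>2"
      unfolding r(2) by (simp add: s_def n field_simps power2_eq_square)
    finally have "(e\<^sup>2 - 4 * a) * (e\<^sup>2 - 4 * b) = 9 * e\<^sup>2 \<longleftrightarrow> e\<^sup>2 = c\<^sup>2 \<or> e\<^sup>2 = l\<^sup>2"
      by auto
    then show ?thesis
      using that \<open>c > 0\<close> \<open>c < l\<close> by (simp add: power2_eq_iff)
  qed
  ultimately show thesis
    using that by blast
qed

section \<open>Evaluation of \<open>xi2\<close> on complements\<close>

lemma xi2_eq_along:
  assumes "distinct vs" "set vs = pverts G"
  shows "xi2 G = eigenvalues_desc (matrix_along vs (ecc_entry G)) ! 1"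
  unfolding xi2_def eigenvalues_desc_def char_poly_ecc_matrix[OF assms] ..

text \<open>The test plane is spanned by the indicators of \<open>{a, b}\<close> and
  \<open>{d, e}\<close>. As no arc joins the two edges, the form has no mixed term: it is
  \<open>4 s^2 + 4 t^2\<close>, twice the squared norm \<open>2 s^2 + 2 t^2\<close>.\<close>

lemma xi2_compl_tree_ge_2:
  assumes T: "is_tree T" and card: "card (pverts T) \<ge> 2"
    and no_dom: "\<And>u v. \<not> dominating_edge T u v"
  shows "xi2 (compl_graph T) \<ge> 2"
proof -
  note G = is_tree_pair_graph[OF T]
  note arcs = pair_graph_arcs[OF G]
  obtain vs where vs: "distinct vs" "set vs = pverts T"
    using finite_distinct_list[of "pverts T"] card by (metis card.infinite not_numeral_le_zero)
  obtain a b d e where ab: "(a, b) \<in> parcs T" and de: "(d, e) \<in> parcs T"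
    and dist: "distinct [a, b, d, e]" and ind: "({a, b} \<times> {d, e}) \<inter> parcs T = {}"
    using is_tree_no_dominating_edge_induced_2K2[OF T card no_dom] .
  define f where "f = ecc_entry (compl_graph T)"
  have f: "f x y = (if (x, y) \<in> parcs T then 2 else 0)" if "x \<in> pverts T" "y \<in> pverts T" for x y
    unfolding f_def using ecc_entry_compl_graph[OF G is_tree_no_isolated[OF T card] no_dom that] .
  let ?F = "{a, b, d, e}"
  have F: "?F \<subseteq> set vs"
    using arcs(2,3)[OF ab] arcs(2,3)[OF de] by (simp add: vs(2))
  have fF: "f x y = (if (x, y) \<in> {(a, b), (b, a), (d, e), (e, d)} then 2 else 0)"
    if "x \<in> ?F" "y \<in> ?F" for x y
  proof -
    have "(x, y) \<in> parcs T \<longleftrightarrow> (x, y) \<in> {(a, b), (b, a), (d, e), (e, d)}"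
      using that ab de arcs(1)[OF ab] arcs(1)[OF de] ind arcs(1)[of x y] arcs(4)[of x y] dist by blast
    then show ?thesis
      using f[of x y] F that vs(2) by auto
  qed
  have "2 \<le> eigenvalues_desc (matrix_along vs f) ! 1"
  proof (rule second_eigenvalue_ge[OF vs(1)])
    show "2 \<le> length vs"
      using card vs distinct_card by fastforce
    show "f x y = f y x" if "x \<in> set vs" "y \<in> set vs" for x y
      using f[of x y] f[of y x] that vs(2) arcs(1)[of x y] arcs(1)[of y x] by auto
    fix s t :: real
    define w where "w v = s * of_bool (v \<in> {a, b}) + t * of_bool (v \<in> {d, e})" for v
    have w: "w a = s" "w b = s" "w d = t" "w e = t" and w0: "v \<notin> ?F \<Longrightarrow> w v = 0" for v
      using dist by (auto simp: w_def)
    show "s = 0 \<and> t = 0"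
      if "\<forall>v\<in>set vs. s * of_bool (v \<in> {a, b}) + t * of_bool (v \<in> {d, e}) = 0"
      using that F w unfolding w_def[symmetric] by auto
    have supp: "sum g (set vs) = g a + g b + g d + g e" if "\<And>v. v \<notin> ?F \<Longrightarrow> g v = 0" for g :: "'a \<Rightarrow> real"
    proof -
      have "sum g (set vs) = sum g ?F"
        using that F by (intro sum.mono_neutral_right) auto
      then show ?thesis
        using dist by simp
    qed
    have "(\<Sum>v\<in>set vs. (w v)\<^sup>2) = 2 * s\<^sup>2 + 2 * t\<^sup>2"
      by (subst supp) (simp_all add: w w0)
    moreover have "(\<Sum>x\<in>set vs. \<Sum>y\<in>set vs. f x y * w x * w y) = 4 * s\<^sup>2 + 4 * t\<^sup>2"
    proof -
      have "(\<Sum>y\<in>set vs. f x y * w x * w y) =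
          w x * (s * (f x a + f x b) + t * (f x d + f x e))" for x
        by (subst supp) (simp_all add: w w0 algebra_simps)
      moreover have "f a a = 0" "f a b = 2" "f a d = 0" "f a e = 0" "f b a = 2" "f b b = 0" "f b d = 0"
        "f b e = 0" "f d a = 0" "f d b = 0" "f d d = 0" "f d e = 2" "f e a = 0" "f e b = 0" "f e d = 2"
        "f e e = 0"
        using dist by (auto simp: fF)
      ultimately show ?thesis
        by (simp, subst supp) (simp_all add: w w0 power2_eq_square)
    qed
    ultimately show "2 * (\<Sum>v\<in>set vs. (s * of_bool (v \<in> {a, b}) + t * of_bool (v \<in> {d, e}))\<^sup>2)
      \<le> (\<Sum>x\<in>set vs. \<Sum>y\<in>set vs. f x y * (s * of_bool (x \<in> {a, b}) + t * of_bool (x \<in> {d, e})) *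
          (s * of_bool (y \<in> {a, b}) + t * of_bool (y \<in> {d, e})))"
      unfolding w_def[symmetric] by simp
  qed
  then show ?thesis
    using xi2_eq_along[of vs "compl_graph T"] vs by (simp add: f_def)
qed

text \<open>For \<open>e > 0\<close> an eigenfunction is determined by its values at the centres, as
  a leaf carries \<open>2 / e\<close> times the value of its centre. What remains is a 2 by 2
  system, solvable nontrivially exactly when \<open>e\<close> satisfies the equation of
  \<open>double_star_eigenvalue_equation\<close>.\<close>

lemma xi2_compl_double_star:
  assumes ds: "double_star G u v A B"
  shows "xi2 (compl_graph G) = double_star_xi2 (card A + card B + 2) (card A * card B)"
proof -
  note G = double_star_pair_graph[OF ds]
  have V: "pverts G = {u, v} \<union> A \<union> B" and fin: "finite A" "finite B" and "A \<noteq> {}" "B \<noteq> {}"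
    and dis: "A \<inter> B = {}" "u \<noteq> v" "u \<notin> A" "u \<notin> B" "v \<notin> A" "v \<notin> B"
    using ds by (auto simp: double_star_def)
  obtain vs where vs: "distinct vs" "set vs = pverts G"
    using finite_distinct_list[of "pverts G"] fin V by auto
  define f where "f = ecc_entry (compl_graph G)"
  have f: "f x y = (if (x, y) \<in> {(u, v), (v, u)} then 3 else if (x, y) \<in> parcs G then 2 else 0)"
    if "x \<in> set vs" "y \<in> set vs" for x y
    unfolding f_def using ecc_entry_compl_double_star[OF ds] that vs(2) by simp
  define a b where "a = card A" and "b = card B"
  have ab: "a \<ge> 1" "b \<ge> 1"
    using fin \<open>A \<noteq> {}\<close> \<open>B \<noteq> {}\<close> by (auto simp: a_def b_def Suc_le_eq card_gt_0_iff)
  define c where "c = double_star_xi2 (a + b + 2) (a * b)"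
  obtain l where cl: "0 < c" "c < l" and eq: "\<And>e :: real. 0 < e \<Longrightarrow>
      (e\<^sup>2 - 4 * a) * (e\<^sup>2 - 4 * b) = 9 * e\<^sup>2 \<longleftrightarrow> e = c \<or> e = l"
    by (rule double_star_eigenvalue_equation[OF refl ab, folded c_def]) (rule that)
  have sumV: "sum g (set vs) = g u + g v + sum g A + sum g B" for g :: "'a \<Rightarrow> real"
    unfolding vs(2) V using dis fin by (simp add: sum.union_disjoint Un_assoc add.assoc)
  let ?E = "\<lambda>e y. \<forall>x\<in>set vs. (\<Sum>w\<in>set vs. f x w * y w) = e * y x"
  have eigvec_iff: "?E e y \<longleftrightarrow> 3 * y v + 2 * sum y A = e * y u \<and> 3 * y u + 2 * sum y B = e * y v \<and>
      (\<forall>x\<in>A. 2 * y u = e * y x) \<and> (\<forall>x\<in>B. 2 * y v = e * y x)" for e and y :: "'a \<Rightarrow> real"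
  proof -
    note arcs_iff = double_star_arcs_iff[OF ds]
    have mem: "u \<in> set vs" "v \<in> set vs" "x \<in> A \<Longrightarrow> x \<in> set vs" "x \<in> B \<Longrightarrow> x \<in> set vs" for x
      by (auto simp: vs(2) V)
    have ru: "f u u = 0" "f u v = 3" "x \<in> A \<Longrightarrow> f u x = 2" "x \<in> B \<Longrightarrow> f u x = 0" for x
      using dis by (auto simp: f mem arcs_iff)
    have rv: "f v v = 0" "f v u = 3" "x \<in> A \<Longrightarrow> f v x = 0" "x \<in> B \<Longrightarrow> f v x = 2" for x
      using dis by (auto simp: f mem arcs_iff)
    have rA: "f x u = 2" "f x v = 0" "y \<in> A \<Longrightarrow> f x y = 0" "y \<in> B \<Longrightarrow> f x y = 0" if "x \<in> A" for x y
      using dis that by (auto simp: f mem arcs_iff)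
    have rB: "f x u = 0" "f x v = 2" "y \<in> A \<Longrightarrow> f x y = 0" "y \<in> B \<Longrightarrow> f x y = 0" if "x \<in> B" for x y
      using dis that by (auto simp: f mem arcs_iff)
    have "(\<Sum>w\<in>set vs. f u w * y w) = 3 * y v + 2 * sum y A"
      unfolding sumV by (simp add: ru sum_distrib_left)
    moreover have "(\<Sum>w\<in>set vs. f v w * y w) = 3 * y u + 2 * sum y B"
      unfolding sumV by (simp add: rv sum_distrib_left)
    moreover have "(\<Sum>w\<in>set vs. f x w * y w) = 2 * y u" if "x \<in> A" for x
      unfolding sumV using that by (simp add: rA)
    moreover have "(\<Sum>w\<in>set vs. f x w * y w) = 2 * y v" if "x \<in> B" for x
      unfolding sumV using that by (simp add: rB)
    moreover have "(\<forall>x\<in>set vs. P x) \<longleftrightarrow> P u \<and> P v \<and> (\<forall>x\<in>A. P x) \<and> (\<forall>x\<in>B. P x)" for P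
      unfolding vs(2) V by blast
    ultimately show ?thesis
      by simp
  qed
  have centers: "(e\<^sup>2 - 4 * a) * y u = 3 * e * y v" "(e\<^sup>2 - 4 * b) * y v = 3 * e * y u"
    "\<forall>x\<in>A. y x = 2 * y u / e" "\<forall>x\<in>B. y x = 2 * y v / e"
    if E: "?E e y" and e: "e > 0" for e y
  proof -
    from E have E': "3 * y v + 2 * sum y A = e * y u" "3 * y u + 2 * sum y B = e * y v"
        "\<forall>x\<in>A. 2 * y u = e * y x" "\<forall>x\<in>B. 2 * y v = e * y x"
      unfolding eigvec_iff by auto
    show A: "\<forall>x\<in>A. y x = 2 * y u / e" and B: "\<forall>x\<in>B. y x = 2 * y v / e"
      using E'(3,4) e by (auto simp: field_simps)
    have "sum y A = a * (2 * y u / e)" "sum y B = b * (2 * y v / e)"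
      using A B by (simp_all add: a_def b_def)
    with E'(1,2) e show "(e\<^sup>2 - 4 * a) * y u = 3 * e * y v" "(e\<^sup>2 - 4 * b) * y v = 3 * e * y u"
      by (simp_all add: field_simps power2_eq_square)
  qed
  \<comment> \<open>With \<open>y u = 0\<close> the first centre equation gives
    \<open>y v = 0\<close>, and then all leaves vanish. This yields the simplicity of
    \<open>l\<close>.\<close>
  have vanish: "\<forall>x\<in>set vs. y x = 0" if E: "?E e y" and e: "e > 0" and yu: "y u = 0" for e y
    using centers[OF E e] e yu unfolding vs(2) V by auto
  have eigvec_ex: "\<exists>y. ?E e y \<and> y u \<noteq> 0" if e: "e > 0" "e = c \<or> e = l" for e
  proof -
    \<comment> \<open>Normalise the value at \<open>u\<close> to 3; the first centre equation then
      forces the value \<open>q\<close> at \<open>v\<close>. The second centre equation holds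
      because \<open>e\<close> is \<open>c\<close> or \<open>l\<close>.\<close>
    define q where "q = (e\<^sup>2 - 4 * a) / e"
    define y where "y x = (if x = u then 3 else if x = v then q else if x \<in> A then 6 / e else 2 * q / e)" for x
    have y: "y u = 3" "y v = q" "x \<in> A \<Longrightarrow> y x = 6 / e" "x \<in> B \<Longrightarrow> y x = 2 * q / e" for x
      using dis by (auto simp: y_def)
    have sums: "sum y A = a * (6 / e)" "sum y B = b * (2 * q / e)"
      by (simp_all add: y a_def b_def)
    have "3 * q + 2 * (a * (6 / e)) = e * 3"
      using e(1) by (simp add: q_def field_simps power2_eq_square)
    moreover have "3 * 3 + 2 * (b * (2 * q / e)) = e * q"
    proof -
      have eq_q: "e * q = e\<^sup>2 - 4 * a"
        using e(1) by (simp add: q_def)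
      have "e\<^sup>2 * (3 * 3 + 2 * (b * (2 * q / e))) = 9 * e\<^sup>2 + 4 * b * (e * q)"
        using e(1) by (simp add: field_simps power2_eq_square)
      also have "9 * e\<^sup>2 = (e * q) * (e\<^sup>2 - 4 * b)"
        using eq[OF e(1)] e(2) by (simp add: eq_q)
      also have "\<dots> + 4 * b * (e * q) = e\<^sup>2 * (e * q)"
        by (simp add: algebra_simps)
      finally show ?thesis
        using e(1) by simp
    qed
    ultimately have "?E e y"
      unfolding eigvec_iff sums y(1,2) using e(1) by (auto simp: y(3,4))
    then show ?thesis
      using y(1) by (intro exI[of _ y]) simp
  qed
  obtain y where y: "?E l y" "y u \<noteq> 0"
    using eigvec_ex[of l] cl by auto
  obtain z where z: "?E c z" "z u \<noteq> 0"
    using eigvec_ex[of c] cl by auto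
  have u: "u \<in> set vs"
    by (simp add: vs(2) V)
  have "eigenvalues_desc (matrix_along vs f) ! 1 = c"
  proof (rule second_eigenvalue_eq[OF vs(1) _ cl(2) y(1) u y(2) z(1) u z(2) u])
    show "f x w = f w x" if "x \<in> set vs" "w \<in> set vs" for x w
      using f[OF that] f[OF that(2,1)] pair_graph_arcs(1)[OF G, of x w] pair_graph_arcs(1)[OF G, of w x]
      by auto
    show "\<forall>x\<in>set vs. y x = 0" if "?E l y" "y u = 0" for y
      using vanish[OF that(1) _ that(2)] cl by simp
    show "e = l" if E: "?E e y" and x: "x \<in> set vs" "y x \<noteq> 0" and e: "e > c" for e y x
    proof -
      have e0: "e > 0"
        using e cl by simp
      then have "y u \<noteq> 0"
        using vanish[OF E] x by blast
      \<comment> \<open>Substitute one centre equation into the other, then cancel the nonzero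
        \<open>y u\<close>.\<close>
      have "((e\<^sup>2 - 4 * a) * (e\<^sup>2 - 4 * b)) * y u = (e\<^sup>2 - 4 * b) * (3 * e * y v)"
        unfolding centers(1)[OF E e0, symmetric] by (simp only: mult_ac)
      also have "\<dots> = 3 * e * (3 * e * y u)"
        unfolding centers(2)[OF E e0, symmetric] by (simp only: mult_ac)
      finally have "((e\<^sup>2 - 4 * a) * (e\<^sup>2 - 4 * b)) * y u = (9 * e\<^sup>2) * y u"
        by (simp add: power2_eq_square)
      then have "(e\<^sup>2 - 4 * a) * (e\<^sup>2 - 4 * b) = 9 * e\<^sup>2"
        using \<open>y u \<noteq> 0\<close> by (simp only: mult_cancel_right) simp
      then show ?thesis
        using eq[OF e0] e by simp
    qed
  qed
  then show ?thesis
    using xi2_eq_along[of vs "compl_graph G"] vs by (simp add: f_def c_def a_def b_def)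
qed

section \<open>Comparison with the extremal tree\<close>

theorem theorem4p4:
  fixes T :: "'a pair_pre_digraph" and n :: nat
  assumes "is_tree T"
    and "card (pverts T) = n"
    and "n \<ge> 4"
    and "\<not> complete_bipartite_digraph 1 (n - 1) (with_proj T)"
  shows "xi2 (compl_graph T) \<ge> xi2 (compl_graph (tree_n3 n)) \<and>
    (xi2 (compl_graph T) = xi2 (compl_graph (tree_n3 n)) \<longleftrightarrow>
      digraph_iso (with_proj T) (with_proj (tree_n3 n)))"
proof -
  note T = assms(1) and n = assms(3)
  note G = is_tree_pair_graph[OF T]
  note ref = double_star_tree_n3[OF n]
  have wf: "wf_digraph (with_proj T)"
  proof -
    interpret pair_graph T
      by (rule G)
    show ?thesis
      by (rule wf_digraph_axioms)
  qed
  have xi2_ref: "xi2 (compl_graph (tree_n3 n)) = double_star_xi2 n (n - 3)"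
  proof -
    have "card {0 :: nat} + card {3..<n} + 2 = n" "card {0 :: nat} * card {3..<n} = n - 3"
      using n by auto
    then show ?thesis
      using xi2_compl_double_star[OF ref] by (simp only:)
  qed
  show ?thesis
  proof (cases "\<exists>u v. dominating_edge T u v")
    case True
    then obtain u v where dom: "dominating_edge T u v"
      by blast
    have dom': "dominating_edge T v u"
      using dom pair_graph_arcs(1)[OF G] unfolding dominating_edge_def by blast
    \<comment> \<open>An end without a further neighbour would make \<open>T\<close> a star, so both
      leaf sets are nonempty.\<close>
    have star: "\<exists>w. w \<noteq> v \<and> (u, w) \<in> parcs T" if "dominating_edge T u v" for u v
      using is_tree_dominating_leaf_star[OF T that] assms(2,4) by blast
    define A B where "A = {w. w \<noteq> v \<and> (u, w) \<in> parcs T}" and "B = {w. w \<noteq> u \<and> (v, w) \<in> parcs T}"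
    have ds: "double_star T u v A B"
      unfolding A_def B_def
      by (rule is_tree_dominating_edge_double_star[OF T dom star[OF dom] star[OF dom']])
    define a b where "a = card A" and "b = card B"
    have nab: "n = a + b + 2"
      using card_double_star[OF ds] assms(2) by (simp add: a_def b_def)
    have ab: "a \<ge> 1" "b \<ge> 1"
      using ds by (auto simp: double_star_def a_def b_def Suc_le_eq card_gt_0_iff)
    have xi2_T: "xi2 (compl_graph T) = double_star_xi2 n (a * b)"
      using xi2_compl_double_star[OF ds] by (simp add: nab a_def b_def)
    show ?thesis
    proof (cases "a * b = n - 3")
      case True
      then have "a = 1 \<or> b = 1"
        using prod_ge_of_sum(2)[OF nab ab] by simp
      then have "digraph_iso (with_proj T) (with_proj (tree_n3 n))"
      proof
        assume "a = 1"
        then show ?thesis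
          using nab by (intro double_star_digraph_iso[OF ds ref]) (auto simp: a_def b_def)
      next
        assume "b = 1"
        then show ?thesis
          using nab by (intro double_star_digraph_iso[OF double_star_swap[OF ds] ref])
            (auto simp: a_def b_def)
      qed
      then show ?thesis
        using True xi2_T xi2_ref by simp
    next
      case False
      then have "n - 3 < a * b"
        using prod_ge_of_sum(1)[OF nab ab] by simp
      then have less: "xi2 (compl_graph (tree_n3 n)) < xi2 (compl_graph T)"
        unfolding xi2_T xi2_ref using card_prod_bound[OF nab]
        by (intro double_star_xi2_strict_mono) auto
      have "\<not> digraph_iso (with_proj T) (with_proj (tree_n3 n))"
      proof
        assume "digraph_iso (with_proj T) (with_proj (tree_n3 n))"
        \<comment> \<open>The extremal tree would be a double star with \<open>a\<close> and
          \<open>b\<close> leaves, so both complements would have the same \<open>xi2\<close>,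
          against \<open>less\<close>.\<close>
        then obtain u' v' A' B' where "double_star (tree_n3 n) u' v' A' B'" "card A' = a" "card B' = b"
          using digraph_iso_double_star_image[OF ds] unfolding a_def b_def by blast
        then show False
          using xi2_compl_double_star less xi2_T nab by fastforce
      qed
      then show ?thesis
        using less by simp
    qed
  next
    case False
    then have "xi2 (compl_graph T) \<ge> 2"
      using assms(2) n by (intro xi2_compl_tree_ge_2[OF T]) auto
    then have less: "xi2 (compl_graph (tree_n3 n)) < xi2 (compl_graph T)"
      using double_star_xi2_less_2[OF n] xi2_ref by simp
    have "\<not> digraph_iso (with_proj T) (with_proj (tree_n3 n))"
    proof
      assume "digraph_iso (with_proj T) (with_proj (tree_n3 n))"
      \<comment> \<open>The isomorphism is reversed because here only \<open>tree_n3 n\<close> is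
        known to be a double star; its leaf counts pass to \<open>T\<close>.\<close>
      then have "digraph_iso (with_proj (tree_n3 n)) (with_proj T)"
        by (rule digraph_iso_swap[OF wf])
      then obtain u v A B where "double_star T u v A B" "card A = card {0 :: nat}" "card B = card {3..<n}"
        using digraph_iso_double_star_image[OF ref] by blast
      then show False
        using xi2_compl_double_star[of T u v A B] xi2_compl_double_star[OF ref] less by simp
    qed
    then show ?thesis
      using less by simp
  qed
qed

end
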